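(* Let $c$ be a Coxeter element of $W$. Every $c$-cluster in $\Pi(c)$ (i.e. every maximal subset of $\Pi(c)$ consisting of pairwise $c$-compatible weights) is a $\mathbb{Z}$-basis of the weight lattice $P$.
   Context: Let $I$ be a finite type Dynkin diagram (identified with its vertex set, $|I|=n$), with crystallographic root system $\Phi$, simple roots $\{\alpha_i\}_{i\in I}$, fundamental weights $\{\omega_i\}_{i\in I}$, root lattice $Q$, weight lattice $P$, $P_\mathbb{R}=P\otimes\mathbb{R}$, Weyl group $W$ generated by simple reflections $s_i$, and longest element $w_0$. For $i\in I$ let $i^*\in I$ be defined by $\omega_{i^*}=-w_0\omega_i$. A Coxeter element $c\in W$ is a product of all simple reflections, each appearing exactly once. For $i\in I$, $h(i;c)$ denotes the minimal positive integer with $c^{h(i;c)}\omega_i=-\omega_{i^*}$. Put $\Pi(c):=\{c^m\omega_i: i\in I,\ 0\le m\le h(i;c)\}$. Define the bijection $\tau_c:\Pi(c)\to\Pi(c)$ by $\tau_c(-\omega_i)=\omega_i$ for $i\in I$ and $\tau_c(\lambda)=c\lambda$ otherwise. For $\gamma\in Q$, $[\gamma;\alpha_i]$ is the coefficient of $\alpha_i$ in $\gamma$ written in the basis of simple roots, and $[x]_+=\max\{x,0\}$. The $c$-compatibility degree $(\bullet||\bullet)_c$ is the unique function $\Pi(c)\times\Pi(c)\to\mathbb{Z}$ satisfying $(\tau_c\lambda||\tau_c\mu)_c=(\lambda||\mu)_c$ for all $\lambda,\mu$ and $(\omega_i||\lambda)_c=[(c^{-1}-1)\lambda;\alpha_i]_+$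 for all $i\in I$, $\lambda\in\Pi(c)$. Two weights $\lambda,\mu\in\Pi(c)$ are $c$-compatible if $(\lambda||\mu)_c=0$ (this relation is symmetric). *)

theory Defs
  imports Complex_Main
begin

(* Conventions.  The Dynkin diagram I is the finite type 'i; it is encoded by its
   Cartan matrix A, with A i j = <alpha_i^vee, alpha_j>.  Weights are written in
   the basis of fundamental weights: a weight lambda = sum_k lambda k * omega_k
   is the function lambda :: 'i => int, so P = ('i => int).
   Then alpha_j has coordinates (k |-> A k j). *)

definition finite_type_cartan :: "('i::finite \<Rightarrow> 'i \<Rightarrow> int) \<Rightarrow> bool" where
  "finite_type_cartan A \<longleftrightarrow>
     (\<forall>i. A i i = 2) \<and> (\<forall>i j. i \<noteq> j \<longrightarrow> A i j \<le> 0) \<and>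
     (\<forall>i j. A i j = 0 \<longleftrightarrow> A j i = 0) \<and>
     (\<exists>d :: 'i \<Rightarrow> real. (\<forall>i. d i > 0) \<and>
        (\<forall>i j. d i * real_of_int (A i j) = d j * real_of_int (A j i)) \<and>
        (\<forall>x :: 'i \<Rightarrow> real. (\<exists>i. x i \<noteq> 0) \<longrightarrow>
            (\<Sum>i\<in>UNIV. \<Sum>j\<in>UNIV. x i * d i * real_of_int (A i j) * x j) > 0))"

definition fund_weight :: "'i \<Rightarrow> ('i \<Rightarrow> int)" where
  "fund_weight i = (\<lambda>k. if k = i then 1 else 0)"

definition simple_root :: "('i \<Rightarrow> 'i \<Rightarrow> int) \<Rightarrow> 'i \<Rightarrow> ('i \<Rightarrow> int)" where
  "simple_root A i = (\<lambda>k. A k i)"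

text \<open>Simple reflection s_i lambda = lambda - <alpha_i^vee, lambda> alpha_i.\<close>
definition simple_refl :: "('i \<Rightarrow> 'i \<Rightarrow> int) \<Rightarrow> 'i \<Rightarrow> ('i \<Rightarrow> int) \<Rightarrow> ('i \<Rightarrow> int)" where
  "simple_refl A i lam = (\<lambda>k. lam k - lam i * A k i)"

definition word_elt :: "('i \<Rightarrow> 'i \<Rightarrow> int) \<Rightarrow> 'i list \<Rightarrow> ('i \<Rightarrow> int) \<Rightarrow> ('i \<Rightarrow> int)" where
  "word_elt A ws = foldr (\<lambda>i f. simple_refl A i \<circ> f) ws id"

definition weyl_group :: "('i \<Rightarrow> 'i \<Rightarrow> int) \<Rightarrow> (('i \<Rightarrow> int) \<Rightarrow> ('i \<Rightarrow> int)) set" where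
  "weyl_group A = range (word_elt A)"

definition weyl_length :: "('i \<Rightarrow> 'i \<Rightarrow> int) \<Rightarrow> (('i \<Rightarrow> int) \<Rightarrow> ('i \<Rightarrow> int)) \<Rightarrow> nat" where
  "weyl_length A w = (LEAST n. \<exists>ws. length ws = n \<and> word_elt A ws = w)"

definition longest_elt :: "('i \<Rightarrow> 'i \<Rightarrow> int) \<Rightarrow> ('i \<Rightarrow> int) \<Rightarrow> ('i \<Rightarrow> int)" where
  "longest_elt A = (THE w. w \<in> weyl_group A \<and>
                     (\<forall>v \<in> weyl_group A. weyl_length A v \<le> weyl_length A w))"

definition star_idx :: "('i \<Rightarrow> 'i \<Rightarrow> int) \<Rightarrow> 'i \<Rightarrow> 'i" where
  "star_idx A i = (THE j. fund_weight j = (\<lambda>k. - longest_elt A (fund_weight i) k))"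

definition coxeter_element :: "('i::finite \<Rightarrow> 'i \<Rightarrow> int) \<Rightarrow> (('i \<Rightarrow> int) \<Rightarrow> ('i \<Rightarrow> int)) \<Rightarrow> bool" where
  "coxeter_element A c \<longleftrightarrow> (\<exists>ws. distinct ws \<and> set ws = UNIV \<and> c = word_elt A ws)"

definition h_idx :: "('i \<Rightarrow> 'i \<Rightarrow> int) \<Rightarrow> (('i \<Rightarrow> int) \<Rightarrow> ('i \<Rightarrow> int)) \<Rightarrow> 'i \<Rightarrow> nat" where
  "h_idx A c i = (LEAST m. m > 0 \<and> (c ^^ m) (fund_weight i) = (\<lambda>k. - fund_weight (star_idx A i) k))"

definition Pi_c :: "('i \<Rightarrow> 'i \<Rightarrow> int) \<Rightarrow> (('i \<Rightarrow> int) \<Rightarrow> ('i \<Rightarrow> int)) \<Rightarrow> ('i \<Rightarrow> int) set" where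
  "Pi_c A c = {(c ^^ m) (fund_weight i) | i m. m \<le> h_idx A c i}"

definition tau_c :: "(('i \<Rightarrow> int) \<Rightarrow> ('i \<Rightarrow> int)) \<Rightarrow> ('i \<Rightarrow> int) \<Rightarrow> ('i \<Rightarrow> int)" where
  "tau_c c lam = (if \<exists>i. lam = (\<lambda>k. - fund_weight i k)
                  then fund_weight (THE i. lam = (\<lambda>k. - fund_weight i k)) else c lam)"

definition root_coeff :: "('i::finite \<Rightarrow> 'i \<Rightarrow> int) \<Rightarrow> ('i \<Rightarrow> int) \<Rightarrow> 'i \<Rightarrow> int" where
  "root_coeff A gam i = (THE x :: 'i \<Rightarrow> int. gam = (\<lambda>k. \<Sum>j\<in>UNIV. x j * simple_root A j k)) i"

definition is_compat_degree ::
  "('i::finite \<Rightarrow> 'i \<Rightarrow> int) \<Rightarrow> (('i \<Rightarrow> int) \<Rightarrow> ('i \<Rightarrow> int)) \<Rightarrow>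
   (('i \<Rightarrow> int) \<Rightarrow> ('i \<Rightarrow> int) \<Rightarrow> int) \<Rightarrow> bool" where
  "is_compat_degree A c f \<longleftrightarrow>
     (\<forall>lam \<in> Pi_c A c. \<forall>mu \<in> Pi_c A c. f (tau_c c lam) (tau_c c mu) = f lam mu) \<and>
     (\<forall>i. \<forall>lam \<in> Pi_c A c. f (fund_weight i) lam = max 0 (root_coeff A (\<lambda>k. inv c lam k - lam k) i))"

definition compat_degree ::
  "('i::finite \<Rightarrow> 'i \<Rightarrow> int) \<Rightarrow> (('i \<Rightarrow> int) \<Rightarrow> ('i \<Rightarrow> int)) \<Rightarrow>
   ('i \<Rightarrow> int) \<Rightarrow> ('i \<Rightarrow> int) \<Rightarrow> int" where
  "compat_degree A c = (THE f. is_compat_degree A c f \<and>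
      (\<forall>lam mu. (lam \<notin> Pi_c A c \<or> mu \<notin> Pi_c A c) \<longrightarrow> f lam mu = 0))"

definition c_compatible ::
  "('i::finite \<Rightarrow> 'i \<Rightarrow> int) \<Rightarrow> (('i \<Rightarrow> int) \<Rightarrow> ('i \<Rightarrow> int)) \<Rightarrow> ('i \<Rightarrow> int) \<Rightarrow> ('i \<Rightarrow> int) \<Rightarrow> bool" where
  "c_compatible A c lam mu \<longleftrightarrow> compat_degree A c lam mu = 0"

definition pairwise_c_compatible ::
  "('i::finite \<Rightarrow> 'i \<Rightarrow> int) \<Rightarrow> (('i \<Rightarrow> int) \<Rightarrow> ('i \<Rightarrow> int)) \<Rightarrow> ('i \<Rightarrow> int) set \<Rightarrow> bool" where
  "pairwise_c_compatible A c S \<longleftrightarrow>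
     (\<forall>lam \<in> S. \<forall>mu \<in> S. lam \<noteq> mu \<longrightarrow> c_compatible A c lam mu)"

definition c_cluster ::
  "('i::finite \<Rightarrow> 'i \<Rightarrow> int) \<Rightarrow> (('i \<Rightarrow> int) \<Rightarrow> ('i \<Rightarrow> int)) \<Rightarrow> ('i \<Rightarrow> int) set \<Rightarrow> bool" where
  "c_cluster A c S \<longleftrightarrow> S \<subseteq> Pi_c A c \<and> pairwise_c_compatible A c S \<and>
     (\<forall>T. S \<subseteq> T \<and> T \<subseteq> Pi_c A c \<and> pairwise_c_compatible A c T \<longrightarrow> T = S)"

definition Z_basis_of_P :: "('i::finite \<Rightarrow> int) set \<Rightarrow> bool" where
  "Z_basis_of_P S \<longleftrightarrow> finite S \<and>
     (\<forall>v :: 'i \<Rightarrow> int. \<exists>!a :: ('i \<Rightarrow> int) \<Rightarrow> int.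
        (\<forall>x. x \<notin> S \<longrightarrow> a x = 0) \<and> v = (\<lambda>k. \<Sum>x\<in>S. a x * x k))"

end

(*
  Order I along the word of c and split the Cartan matrix as A = low + upp into its lower and upper
  unitriangular parts.  Then c = - low upp^-1, and every weight is uniquely of the form - low x, where
  x = (c^-1 - 1) lambda in the basis of simple roots.  In these coordinates Pi(c) consists of the
  fundamental weights and of the - low x with x a positive root, and compatibility of two positive roots
  x, y says that the Euler form E x y = sum_k d_k x_k (low y)_k satisfies E x y >= 0 and E y x >= 0.
  (The c-orbit of omega_i first meets an antidominant weight at some - omega_j, and j = i* because
  a W-orbit contains only one antidominant weight.)
  This description makes sense for every subset J of I, with the compatibility relation independent
  of J, and is invariant under tau.  A maximal compatible set containing omega_i becomes, after removal
  of omega_i and of the i-th coordinate, a maximal compatible set for J - {i}.  On a set without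
  fundamental weights tau^-1 acts as the linear map c^-1, and some power of tau^-1 produces a
  fundamental weight, so that induction on |J| applies.
*)
theory Submission
  imports Defs "HOL-Analysis.Analysis"
begin

text \<open>The identity c = -\<open>low\<close> \<open>upp\<close>^-1 is back substitution: reading
  the word of c from its last letter, s_i subtracts y_i alpha_i, where y solves \<open>upp\<close> y
  = lambda, so c lambda = lambda - A y = -\<open>low\<close> y. The symmetrizer \<open>d\<close>
  exchanges \<open>low\<close> and \<open>upp\<close>, which gives E (c x) y = - E y x. So the
  Coxeter element preserves E, while a general Weyl group element is only known to preserve E x y +
  E y x; and the degree of two roots collects the negative parts of E in both orders. Some power of
  tau^-1 meets a fundamental weight because an orbit inside the finite set of positive roots would
  be periodic, and its sum over a period would be fixed by c, that is, killed by A. The induction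
  shrinks the diagram but cannot change the index type. For a subset J, roots are restricted by
  support, weights are compared on coordinates in J only, and one order of all letters serves every
  J, so that \<open>low\<close>, \<open>upp\<close> and E never change. As w_0, i* and the degree
  enter as definite descriptions, their existence and uniqueness are part of the proof.\<close>

definition mv :: "('i::finite \<Rightarrow> 'i \<Rightarrow> int) \<Rightarrow> ('i \<Rightarrow> int) \<Rightarrow> 'i \<Rightarrow> int" where
  "mv M x k = (\<Sum>j\<in>UNIV. M k j * x j)"

lemma mv_add: "mv M (\<lambda>j. x j + y j) k = mv M x k + mv M y k"
  by (simp add: mv_def algebra_simps sum.distrib)

lemma mv_diff: "mv M (\<lambda>j. x j - y j) k = mv M x k - mv M y k"
  by (simp add: mv_def algebra_simps sum_subtractf)

lemma mv_minus: "mv M (\<lambda>j. - x j) k = - mv M x k"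
  by (simp add: mv_def sum_negf)

lemma mv_scale: "mv M (\<lambda>j. a * x j) k = a * mv M x k"
  by (simp add: mv_def sum_distrib_left mult.left_commute)

lemma mv_sum: "mv M (\<lambda>j. \<Sum>n\<in>N. x n j) k = (\<Sum>n\<in>N. mv M (x n) k)"
  unfolding mv_def by (simp add: sum_distrib_left) (rule sum.swap)

lemma mv_fund_weight: "mv M (fund_weight i) k = M k i"
proof -
  have "mv M (fund_weight i) k = (\<Sum>j\<in>UNIV. if i = j then M k j else 0)"
    unfolding mv_def fund_weight_def by (rule sum.cong) auto
  then show ?thesis by simp
qed

lemma fund_weight_simps [simp]: "fund_weight i i = 1" "k \<noteq> i \<Longrightarrow> fund_weight i k = 0"
  by (auto simp: fund_weight_def)

lemma fund_weight_nonneg [simp]: "0 \<le> fund_weight i k"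
  by (simp add: fund_weight_def)

lemma fund_weight_eq_iff [simp]: "fund_weight i = fund_weight j \<longleftrightarrow> i = j"
  by (metis fund_weight_simps zero_neq_one)

text \<open>The reflection s_i in simple root coordinates; \<open>mv A\<close> passes from root to
  weight coordinates. Here s_i alters only the coordinate i, which keeps supports under
  control.\<close>

definition root_refl :: "('i::finite \<Rightarrow> 'i \<Rightarrow> int) \<Rightarrow> 'i \<Rightarrow> ('i \<Rightarrow> int) \<Rightarrow> ('i \<Rightarrow> int)" where
  "root_refl A i x = (\<lambda>k. x k - mv A x i * fund_weight i k)"

lemma mv_root_refl: "mv A (root_refl A i x) = simple_refl A i (mv A x)"
  by (rule ext) (simp add: root_refl_def simple_refl_def mv_diff mv_scale mv_fund_weight)

lemma root_refl_other [simp]: "k \<noteq> i \<Longrightarrow> root_refl A i x k = x k"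
  by (simp add: root_refl_def)

lemma word_elt_foldr: "word_elt A vs = foldr (simple_refl A) vs"
proof
  fix l show "word_elt A vs l = foldr (simple_refl A) vs l"
    by (induction vs) (auto simp: word_elt_def)
qed

lemma word_elt_Nil [simp]: "word_elt A [] = id"
  and word_elt_Cons [simp]: "word_elt A (i # vs) l = simple_refl A i (word_elt A vs l)"
  and word_elt_append [simp]: "word_elt A (us @ vs) l = word_elt A us (word_elt A vs l)"
  by (auto simp: word_elt_foldr)

definition root_word :: "('i::finite \<Rightarrow> 'i \<Rightarrow> int) \<Rightarrow> 'i list \<Rightarrow> ('i \<Rightarrow> int) \<Rightarrow> ('i \<Rightarrow> int)" where
  "root_word A vs = foldr (root_refl A) vs"

lemma root_word_simps [simp]: "root_word A [] x = x"
  "root_word A (i # vs) x = root_refl A i (root_word A vs x)"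
  "root_word A (us @ vs) x = root_word A us (root_word A vs x)"
  by (auto simp: root_word_def)

lemma mv_root_word: "mv A (root_word A vs x) = word_elt A vs (mv A x)"
  by (induction vs) (simp_all add: mv_root_refl)

lemma root_refl_minus: "root_refl A i (\<lambda>k. - x k) = (\<lambda>k. - root_refl A i x k)"
  by (rule ext) (simp add: root_refl_def mv_minus)

lemma root_word_minus: "root_word A vs (\<lambda>k. - x k) = (\<lambda>k. - root_word A vs x k)"
  by (induction vs) (simp_all add: root_refl_minus)

lemma simple_refl_lin:
  "simple_refl A i (\<lambda>k. l k - a * m k) = (\<lambda>k. simple_refl A i l k - a * simple_refl A i m k)"
  by (rule ext) (simp add: simple_refl_def algebra_simps)

lemma word_elt_lin:
  "word_elt A vs (\<lambda>k. l k - a * m k) = (\<lambda>k. word_elt A vs l k - a * word_elt A vs m k)"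
  by (induction vs) (simp_all add: simple_refl_lin)

lemma simple_refl_sum:
  "simple_refl A i (\<lambda>k. \<Sum>t\<in>S. a t * f t k) = (\<lambda>k. \<Sum>t\<in>S. a t * simple_refl A i (f t) k)"
  by (rule ext) (simp add: simple_refl_def algebra_simps sum_subtractf sum_distrib_left)

lemma word_elt_sum:
  "word_elt A vs (\<lambda>k. \<Sum>t\<in>S. a t * f t k) = (\<lambda>k. \<Sum>t\<in>S. a t * word_elt A vs (f t) k)"
  by (induction vs) (simp_all add: simple_refl_sum)

lemma root_refl_sum:
  "root_refl A i (\<lambda>k. \<Sum>t\<in>S. a t * f t k) = (\<lambda>k. \<Sum>t\<in>S. a t * root_refl A i (f t) k)"
proof -
  have "mv A (\<lambda>k. \<Sum>t\<in>S. a t * f t k) i = (\<Sum>t\<in>S. a t * mv A (f t) i)"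
    by (simp add: mv_sum mv_scale)
  then show ?thesis
    by (intro ext) (simp add: root_refl_def algebra_simps sum_subtractf sum_distrib_left)
qed

lemma root_word_sum:
  "root_word A vs (\<lambda>k. \<Sum>t\<in>S. a t * f t k) = (\<lambda>k. \<Sum>t\<in>S. a t * root_word A vs (f t) k)"
  by (induction vs) (simp_all add: root_refl_sum)

lemma fund_weight_expand: "(x :: 'i::finite \<Rightarrow> int) = (\<lambda>k. \<Sum>j\<in>UNIV. x j * fund_weight j k)"
proof
  fix k
  have "(\<Sum>j\<in>UNIV. x j * fund_weight j k) = (\<Sum>j\<in>UNIV. if j = k then x j else 0)"
    unfolding fund_weight_def by (rule sum.cong) auto
  then show "x k = (\<Sum>j\<in>UNIV. x j * fund_weight j k)" by simp
qed

lemma root_word_expand: "root_word A vs x k = (\<Sum>j\<in>UNIV. x j * root_word A vs (fund_weight j) k)"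
  by (subst fund_weight_expand[of x], subst root_word_sum) simp

section \<open>The symmetrizer, the triangular splitting and the Euler form\<close>

locale cartan =
  fixes A :: "'i::finite \<Rightarrow> 'i \<Rightarrow> int" and d :: "'i \<Rightarrow> real" and r :: "'i \<Rightarrow> nat" and ws :: "'i list"
  assumes diag: "A i i = 2"
    and offdiag: "i \<noteq> j \<Longrightarrow> A i j \<le> 0"
    and dpos: "d i > 0"
    and dsym: "d i * real_of_int (A i j) = d j * real_of_int (A j i)"
    and posdef: "\<exists>i. y i \<noteq> 0 \<Longrightarrow> (\<Sum>i\<in>UNIV. \<Sum>j\<in>UNIV. y i * d i * real_of_int (A i j) * y j) > 0"
    and r_inj: "inj r"
    and ws_sorted: "sorted_wrt (\<lambda>i j. r i < r j) ws"
    and ws_all: "set ws = UNIV"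
begin

definition low :: "'i \<Rightarrow> 'i \<Rightarrow> int" where
  "low k j = (if k = j then 1 else if r j < r k then A k j else 0)"

definition upp :: "'i \<Rightarrow> 'i \<Rightarrow> int" where
  "upp k j = (if k = j then 1 else if r k < r j then A k j else 0)"

lemma A_low_upp: "A k j = low k j + upp k j"
  using r_inj diag by (auto simp: low_def upp_def dest: injD)

lemma mv_A: "mv A x k = mv low x k + mv upp x k"
  unfolding mv_def by (simp add: A_low_upp algebra_simps sum.distrib)

text \<open>Exchanging \<open>k\<close> and \<open>j\<close> exchanges the two sides of the order,
  so \<open>dsym\<close> makes \<open>low\<close> and \<open>upp\<close> transposes of each other up
  to the symmetrizer.\<close>

lemma d_low: "d k * real_of_int (low k j) = d j * real_of_int (upp j k)"
  using dsym by (auto simp: low_def upp_def)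

text \<open>The invariant form between weight coordinates \<open>l\<close> and root coordinates
  \<open>x\<close>, normalized by (omega_k, alpha_k) = \<open>d k\<close>; thus \<open>d k\<close>
  is half the squared length of alpha_k.\<close>

definition pairing :: "('i \<Rightarrow> int) \<Rightarrow> ('i \<Rightarrow> int) \<Rightarrow> real" where
  "pairing l x = (\<Sum>k\<in>UNIV. d k * real_of_int (l k) * real_of_int (x k))"

definition euler :: "('i \<Rightarrow> int) \<Rightarrow> ('i \<Rightarrow> int) \<Rightarrow> real" where
  "euler x y = pairing (mv low y) x"

lemma euler_upp: "euler x y = pairing (mv upp x) y"
proof -
  have "euler x y = (\<Sum>k\<in>UNIV. \<Sum>j\<in>UNIV. (d k * real_of_int (low k j)) * real_of_int (y j) * real_of_int (x k))"
    by (simp add: euler_def pairing_def mv_def sum_distrib_left sum_distrib_right mult.assoc)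
  also have "\<dots> = (\<Sum>j\<in>UNIV. \<Sum>k\<in>UNIV. (d j * real_of_int (upp j k)) * real_of_int (y j) * real_of_int (x k))"
    by (subst sum.swap) (simp add: d_low)
  also have "\<dots> = pairing (mv upp x) y"
    by (simp add: pairing_def mv_def sum_distrib_left sum_distrib_right mult_ac)
  finally show ?thesis .
qed

lemma pairing_add: "pairing (\<lambda>k. l k + m k) x = pairing l x + pairing m x"
  by (simp add: pairing_def algebra_simps sum.distrib)

lemma pairing_diff: "pairing (\<lambda>k. l k - m k) x = pairing l x - pairing m x"
  by (simp add: pairing_def algebra_simps sum_subtractf)

lemma pairing_diff_right: "pairing l (\<lambda>k. x k - y k) = pairing l x - pairing l y"
  by (simp add: pairing_def algebra_simps sum_subtractf)

lemma pairing_scale: "pairing (\<lambda>k. a * l k) x = a * pairing l x"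
  by (simp add: pairing_def sum_distrib_left mult_ac)

lemma pairing_scale_right: "pairing l (\<lambda>k. a * x k) = a * pairing l x"
  by (simp add: pairing_def sum_distrib_left mult_ac)

lemma pairing_minus: "pairing (\<lambda>k. - l k) x = - pairing l x"
  and pairing_minus_right: "pairing l (\<lambda>k. - x k) = - pairing l x"
  by (simp_all add: pairing_def sum_negf)

lemma pairing_fund_weight: "pairing l (fund_weight i) = d i * l i"
proof -
  have "pairing l (fund_weight i) = (\<Sum>k\<in>UNIV. if k = i then d k * l k else 0)"
    unfolding pairing_def fund_weight_def by (rule sum.cong) auto
  then show ?thesis by simp
qed

lemma pairing_fund_weight_left: "pairing (fund_weight i) x = d i * x i"
proof -
  have "pairing (fund_weight i) x = (\<Sum>k\<in>UNIV. if k = i then d k * x k else 0)"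
    unfolding pairing_def fund_weight_def by (rule sum.cong) auto
  then show ?thesis by simp
qed

text \<open>The two parts of A = \<open>low\<close> + \<open>upp\<close> contribute the two orders
  of the arguments: the invariant form is the symmetrization of the Euler form.\<close>

lemma pairing_A: "pairing (mv A x) y = euler x y + euler y x"
proof -
  have "pairing (mv A x) y = pairing (\<lambda>k. mv low x k + mv upp x k) y"
    by (rule arg_cong[of _ _ "\<lambda>l. pairing l y"]) (rule ext, rule mv_A)
  also have "\<dots> = euler y x + euler x y"
    by (simp add: pairing_add euler_def[of y x] euler_upp[of x y])
  finally show ?thesis by simp
qed

lemma pairing_A_self: "pairing (mv A x) x = (\<Sum>i\<in>UNIV. \<Sum>j\<in>UNIV. real_of_int (x i) * d i * real_of_int (A i j) * real_of_int (x j))"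
  by (simp add: pairing_def mv_def sum_distrib_left sum_distrib_right mult_ac)

lemma euler_pos: "x i \<noteq> 0 \<Longrightarrow> euler x x > 0"
  using posdef[of "\<lambda>i. real_of_int (x i)"] pairing_A_self[of x] pairing_A[of x x] by fastforce

lemma mv_A_inj: assumes "mv A x = mv A y" shows "x = y"
proof (rule ccontr)
  assume "x \<noteq> y"
  let ?z = "\<lambda>k. x k - y k"
  have "mv A ?z = (\<lambda>k. 0)" using assms by (auto simp: mv_diff)
  then have "pairing (mv A ?z) ?z = 0" by (simp add: pairing_def)
  then have "euler ?z ?z = 0" by (simp add: pairing_A)
  moreover obtain k where "x k \<noteq> y k" using \<open>x \<noteq> y\<close> by auto
  then have "euler ?z ?z > 0" by (intro euler_pos[of _ k]) auto
  ultimately show False by simp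
qed

lemma pairing_refl: "pairing (simple_refl A i l) (root_refl A i x) = pairing l x"
proof -
  have 1: "pairing (\<lambda>k. A k i) x = d i * mv A x i"
  proof -
    have "pairing (\<lambda>k. A k i) x = (\<Sum>k\<in>UNIV. (d k * A k i) * x k)" by (simp add: pairing_def)
    also have "\<dots> = (\<Sum>k\<in>UNIV. (d i * A i k) * x k)" by (simp add: dsym)
    also have "\<dots> = d i * mv A x i" by (simp add: mv_def sum_distrib_left mult_ac)
    finally show ?thesis .
  qed
  have "pairing (simple_refl A i l) (root_refl A i x)
     = pairing l x - mv A x i * (d i * l i) - l i * (d i * mv A x i) + l i * (mv A x i * (d i * A i i))"
    unfolding simple_refl_def root_refl_def
    by (simp add: pairing_diff pairing_diff_right pairing_scale pairing_scale_right pairing_fund_weight 1)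
  then show ?thesis by (simp add: diag)
qed

lemma pairing_word: "pairing (word_elt A vs l) (root_word A vs x) = pairing l x"
  by (induction vs) (simp_all add: pairing_refl)

text \<open>The diagonal value is half of the Weyl invariant \<open>pairing (mv A x) x\<close>; the
  Euler form itself depends on the chosen order.\<close>

lemma euler_word: "euler (root_word A vs x) (root_word A vs x) = euler x x"
  using pairing_word[of vs "mv A x" x] by (simp add: mv_root_word[symmetric] pairing_A)

lemma simple_refl_invol [simp]: "simple_refl A i (simple_refl A i l) = l"
  by (rule ext) (simp add: simple_refl_def diag)

lemma root_refl_invol [simp]: "root_refl A i (root_refl A i x) = x"
  by (rule mv_A_inj) (simp add: mv_root_refl)

lemma word_rev [simp]: "word_elt A (rev vs) (word_elt A vs l) = l"
  by (induction vs arbitrary: l) simp_all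

lemma word_rev' [simp]: "word_elt A vs (word_elt A (rev vs) l) = l"
  using word_rev[of "rev vs"] by simp

lemma root_word_rev [simp]: "root_word A (rev vs) (root_word A vs x) = x"
  by (induction vs arbitrary: x) simp_all

lemma root_word_rev' [simp]: "root_word A vs (root_word A (rev vs) x) = x"
  using root_word_rev[of "rev vs"] by simp

lemma root_word_cong: "word_elt A us = word_elt A vs \<Longrightarrow> root_word A us = root_word A vs"
  by (rule ext, rule mv_A_inj) (simp add: mv_root_word)

section \<open>Roots, their signs and their finiteness\<close>

text \<open>Roots are described without reference to the Weyl group, as the integral vectors of length \<open>d i\<close>
  whose coroot \<open>(d j * x j / d i)\<^sub>j\<close> is integral as well.\<close>

definition root :: "('i \<Rightarrow> int) \<Rightarrow> bool" where
  "root x \<longleftrightarrow> (\<exists>i. euler x x = d i \<and> (\<forall>j. \<exists>m::int. d j * x j = d i * m))"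

definition posroot :: "('i \<Rightarrow> int) \<Rightarrow> bool" where
  "posroot x \<longleftrightarrow> root x \<and> (\<forall>k. 0 \<le> x k)"

lemma euler_fund_weight: "euler (fund_weight i) (fund_weight i) = d i"
  by (simp add: euler_def pairing_fund_weight mv_fund_weight low_def)

lemma posroot_fund_weight [simp]: "posroot (fund_weight i)"
  unfolding posroot_def root_def
proof (intro conjI allI exI[of _ i])
  fix j
  show "\<exists>m::int. d j * fund_weight i j = d i * m"
    by (rule exI[of _ "fund_weight i j"]) (auto simp: fund_weight_def)
qed (simp_all add: euler_fund_weight)

lemma root_nonzero: assumes "root x" obtains k where "x k \<noteq> 0"
proof -
  have "\<not> (\<forall>k. x k = 0)"
  proof
    assume "\<forall>k. x k = 0"
    then have "euler x x = 0" by (simp add: euler_def pairing_def)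
    with assms dpos show False unfolding root_def by (metis less_irrefl)
  qed
  then show ?thesis using that by auto
qed

lemma root_minus [simp]: "root (\<lambda>k. - x k) \<longleftrightarrow> root x"
proof -
  have "root (\<lambda>k. - x k)" if "root x" for x
  proof -
    from that obtain i where i: "euler x x = d i" "\<forall>j. \<exists>m::int. d j * x j = d i * m"
      unfolding root_def by auto
    have "mv low (\<lambda>k. - x k) = (\<lambda>k. - mv low x k)" by (rule ext) (rule mv_minus)
    then have "euler (\<lambda>k. - x k) (\<lambda>k. - x k) = d i"
      using i by (simp add: euler_def pairing_minus pairing_minus_right)
    moreover have "\<exists>m::int. d j * real_of_int (- x j) = d i * m" for j
    proof -
      from i obtain m :: int where "d j * x j = d i * m" by auto
      then show ?thesis by (intro exI[of _ "-m"]) simp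
    qed
    ultimately show ?thesis unfolding root_def by blast
  qed
  from this[of x] this[of "\<lambda>k. - x k"] show ?thesis by auto
qed

text \<open>The length is invariant. For the coroot condition only coordinate \<open>i\<close>
  changes, and \<open>dsym\<close> writes \<open>d i * mv A x i\<close> as an integral combination
  of the numbers \<open>d j * x j\<close>.\<close>

lemma root_refl_root: assumes "root x" shows "root (root_refl A i x)"
proof -
  from assms obtain e where e: "euler x x = d e" "\<forall>j. \<exists>m::int. d j * x j = d e * m"
    unfolding root_def by auto
  then obtain m :: "'i \<Rightarrow> int" where m: "\<And>j. d j * x j = d e * m j" by metis
  have "euler (root_refl A i x) (root_refl A i x) = d e"
    using euler_word[of "[i]" x] e by simp
  moreover have "\<exists>n::int. d j * root_refl A i x j = d e * n" for j
  proof (cases "j = i")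
    case False then show ?thesis using m by auto
  next
    case True
    have "d i * mv A x i = (\<Sum>j\<in>UNIV. (d i * A i j) * x j)"
      by (simp add: mv_def sum_distrib_left mult_ac)
    also have "\<dots> = (\<Sum>j\<in>UNIV. A j i * (d j * x j))" by (simp add: dsym mult_ac)
    also have "\<dots> = d e * (\<Sum>j\<in>UNIV. A j i * m j)" by (simp add: m sum_distrib_left mult_ac)
    finally have "d j * root_refl A i x j = d e * (m i - (\<Sum>j\<in>UNIV. A j i * m j))"
      using True m[of i] by (simp add: root_refl_def algebra_simps)
    then show ?thesis by (metis of_int_diff of_int_sum)
  qed
  ultimately show ?thesis unfolding root_def by blast
qed

lemma root_word_root: "root x \<Longrightarrow> root (root_word A vs x)"
  by (induction vs) (auto intro: root_refl_root)

text \<open>The positive and negative parts of a root of length \<open>d i\<close> both have lengths in \<open>d i * \<int>\<close>,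
  and their mixed term does not decrease the length, so one of the parts vanishes.\<close>

lemma root_sign: assumes "root x" shows "posroot x \<or> posroot (\<lambda>k. - x k)"
proof -
  from assms obtain e where e: "euler x x = d e" "\<forall>j. \<exists>m::int. d j * x j = d e * m"
    unfolding root_def by auto
  then obtain m :: "'i \<Rightarrow> int" where m: "\<And>j. d j * x j = d e * m j" by metis
  define p where "p = (\<lambda>k. max 0 (x k))"
  define n where "n = (\<lambda>k. max 0 (- x k))"
  have ge: "euler y y \<ge> d e" if "\<And>j. \<exists>m::int. d j * y j = d e * m" "y i \<noteq> 0" for y :: "'i \<Rightarrow> int" and i
  proof -
    from that obtain m :: "'i \<Rightarrow> int" where m: "\<And>j. d j * y j = d e * m j" by metis
    have "euler y y = (\<Sum>k\<in>UNIV. (d k * y k) * mv low y k)"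
      by (simp add: euler_def pairing_def mult_ac)
    also have "\<dots> = d e * real_of_int (\<Sum>k\<in>UNIV. m k * mv low y k)"
      by (simp add: m sum_distrib_left mult_ac)
    finally have eq: "euler y y = d e * real_of_int (\<Sum>k\<in>UNIV. m k * mv low y k)" .
    then have "real_of_int (\<Sum>k\<in>UNIV. m k * mv low y k) > 0"
      using euler_pos[of y i] that(2) dpos[of e] by (simp add: zero_less_mult_iff)
    then have "(\<Sum>k\<in>UNIV. m k * mv low y k) \<ge> 1" unfolding of_int_0_less_iff by simp
    then have "real_of_int (\<Sum>k\<in>UNIV. m k * mv low y k) \<ge> 1" by linarith
    then show ?thesis unfolding eq using dpos[of e] by (simp only: mult_le_cancel_left1) auto
  qed
  have pm: "\<exists>m::int. d j * p j = d e * m" for j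
    using m[of j] by (cases "x j \<ge> 0") (auto simp: p_def max_def intro: exI[of _ 0])
  have nm: "\<exists>m::int. d j * n j = d e * m" for j
    using m[of j] by (cases "x j \<ge> 0") (auto simp: n_def max_def intro: exI[of _ "- m j"] exI[of _ 0])
  have x: "x = (\<lambda>k. p k - n k)" by (rule ext) (auto simp: p_def n_def)
  have Ax: "mv A x = (\<lambda>k. mv A p k - mv A n k)" by (subst x) (rule ext, rule mv_diff)
  have "pairing (mv A x) x = pairing (\<lambda>k. mv A p k - mv A n k) (\<lambda>k. p k - n k)"
    using x Ax by metis
  also have "\<dots> = pairing (mv A p) p + pairing (mv A n) n - pairing (mv A p) n - pairing (mv A n) p"
    by (simp add: pairing_diff pairing_diff_right)
  finally have "2 * euler x x = 2 * euler p p + 2 * euler n n - 2 * pairing (mv A p) n"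
    by (simp add: pairing_A)
  moreover have "pairing (mv A p) n \<le> 0"
    unfolding pairing_def
  proof (rule sum_nonpos)
    fix k
    have "real_of_int (mv A p k * n k) \<le> 0"
    proof (cases "n k = 0")
      case False
      then have "x k < 0" "n k > 0" "p k = 0" by (auto simp: n_def p_def max_def split: if_splits)
      have "mv A p k \<le> 0" unfolding mv_def
      proof (rule sum_nonpos)
        fix j show "A k j * p j \<le> 0"
          using offdiag[of k j] \<open>p k = 0\<close> by (cases "j = k") (auto simp: p_def mult_nonpos_nonneg)
      qed
      then show ?thesis using \<open>n k > 0\<close> by (simp add: mult_nonpos_nonneg)
    qed simp
    then show "d k * real_of_int (mv A p k) * real_of_int (n k) \<le> 0"
      using dpos[of k] by (simp add: mult.assoc mult_nonneg_nonpos)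
  qed
  ultimately have le: "euler p p + euler n n \<le> d e" using e by linarith
  show ?thesis
  proof (rule ccontr)
    assume "\<not> ?thesis"
    then obtain k l where "x k < 0" "x l > 0"
      using assms unfolding posroot_def by (auto simp: not_le)
    then have "euler p p \<ge> d e" "euler n n \<ge> d e"
      using ge[OF pm, of l] ge[OF nm, of k] by (auto simp: p_def n_def)
    with le dpos[of e] show False by linarith
  qed
qed

lemma not_posroot_both: "posroot x \<Longrightarrow> \<not> posroot (\<lambda>k. - x k)"
  by (metis neg_0_le_iff_le order_antisym posroot_def root_nonzero)

lemma posroot_pos: assumes "posroot x" obtains k where "x k > 0"
  using assms root_nonzero unfolding posroot_def by (metis order_le_less)

lemma posrootI: assumes "root x" "x k > 0" shows "posroot x"
  using root_sign[OF assms(1)] assms(2) unfolding posroot_def by (metis neg_0_le_iff_le not_le)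

text \<open>A positive coordinate other than \<open>i\<close> survives the reflection, and then
  \<open>posrootI\<close> applies. Otherwise \<open>x\<close> is a multiple of the simple root
  \<open>i\<close>, and integrality of the coroot forces the multiple to be 1.\<close>

lemma posroot_refl: assumes x: "posroot x" and ne: "x \<noteq> fund_weight i" shows "posroot (root_refl A i x)"
proof (cases "\<exists>k. k \<noteq> i \<and> x k > 0")
  case True
  then obtain k where k: "k \<noteq> i" "x k > 0" by auto
  show ?thesis
  proof (rule posrootI[of _ k])
    show "root (root_refl A i x)" using x by (simp add: root_refl_root posroot_def)
  qed (use k in simp)
next
  case False
  then have 0: "x k = 0" if "k \<noteq> i" for k using x that unfolding posroot_def by (metis order_le_less)
  obtain k where "x k > 0" using posroot_pos[OF x] .
  then have pos: "x i > 0" using 0 by (cases "k = i") auto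
  have xe: "x = (\<lambda>k. x i * fund_weight i k)" using 0 by (auto simp: fund_weight_def)
  obtain e where e: "euler x x = d e" "\<forall>j. \<exists>m::int. d j * x j = d e * m"
    using x unfolding posroot_def root_def by auto
  then obtain m :: int where m: "d i * x i = d e * m" by blast
  \<comment> \<open>The length index \<open>e\<close> need not be \<open>i\<close> a priori.
    Evaluating the form on a multiple of alpha_i gives \<open>d e = x i * (d i * x i)\<close>, and
    the coroot condition replaces the last factor by \<open>d e * m\<close>.\<close>
  have "2 * euler x x = pairing (mv A x) x" by (simp add: pairing_A)
  also have "\<dots> = pairing (mv A x) (\<lambda>k. x i * fund_weight i k)"
    using arg_cong[OF xe, of "pairing (mv A x)"] .
  also have "\<dots> = x i * (d i * mv A x i)" by (simp add: pairing_scale_right pairing_fund_weight)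
  also have "mv A x i = mv A (\<lambda>k. x i * fund_weight i k) i"
    using arg_cong[OF xe, of "\<lambda>x. mv A x i"] .
  also have "\<dots> = x i * 2" by (simp add: mv_scale mv_fund_weight diag)
  finally have "d e = x i * (d i * x i)" using e by simp
  then have "d e = x i * (d e * m)" using m by simp
  then have "real_of_int (x i * m) = 1" using dpos[of e] by simp
  then have "x i * m = 1" by linarith
  then have "x i = 1" using pos by (metis zmult_eq_1_iff neg_0_less_iff_less not_one_less_zero)
  then have "x = fund_weight i" using xe by auto
  with ne show ?thesis by simp
qed

lemma root_refl_fund_weight: "root_refl A i (fund_weight i) = (\<lambda>k. - fund_weight i k)"
  by (rule ext) (simp add: root_refl_def mv_fund_weight diag)

text \<open>By compactness of the sphere the definite form is bounded below by a positive multiple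
  of the squared norm, and only finitely many integral vectors lie in a bounded region.\<close>

lemma finite_roots: "finite {x. root x}"
proof -
  define f where "f = (\<lambda>y::real^'i. \<Sum>i\<in>UNIV. \<Sum>j\<in>UNIV. y $ i * d i * real_of_int (A i j) * y $ j)"
  have cont: "continuous_on (sphere 0 1) f" unfolding f_def by (intro continuous_intros)
  have ne: "sphere (0::real^'i) 1 \<noteq> {}" by simp
  obtain u where u: "u \<in> sphere 0 1" "\<And>y. y \<in> sphere 0 1 \<Longrightarrow> f u \<le> f y"
    using continuous_attains_inf[OF compact_sphere ne cont] by blast
  have fu: "f u > 0"
  proof -
    have "u \<noteq> 0" using u(1) by auto
    then have "\<exists>i. u $ i \<noteq> 0" by (simp add: vec_eq_iff)
    then show ?thesis unfolding f_def by (rule posdef)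
  qed
  have scale: "f (a *\<^sub>R y) = a^2 * f y" for a y
    unfolding f_def by (simp add: sum_distrib_left power2_eq_square mult_ac)
  have low: "f y \<ge> f u * (norm y)^2" for y
  proof (cases "y = 0")
    case True then show ?thesis by (simp add: f_def)
  next
    case False
    have "f y = f (norm y *\<^sub>R (inverse (norm y) *\<^sub>R y))" using False by simp
    also have "\<dots> = (norm y)^2 * f (inverse (norm y) *\<^sub>R y)" by (rule scale)
    also have "\<dots> \<ge> (norm y)^2 * f u"
      using False by (intro mult_left_mono u(2)) auto
    finally show ?thesis by (simp add: mult.commute)
  qed
  \<comment> \<open>Summing over all \<open>i\<close> bounds \<open>2 * d e / f u\<close> for
    whichever \<open>e\<close> gives the length of the root.\<close>
  define K where "K = (\<Sum>i\<in>UNIV. 2 * d i / f u)"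
  define N where "N = \<lceil>K\<rceil>"
  have "x k \<in> {-N..N}" if "root x" for x k
  proof -
    define y :: "real^'i" where "y = (\<chi> i. real_of_int (x i))"
    from that obtain e where e: "euler x x = d e" unfolding root_def by auto
    have "f y = pairing (mv A x) x" by (simp add: f_def y_def pairing_A_self)
    then have "f y = 2 * d e" by (simp add: pairing_A e)
    then have "(norm y)^2 \<le> 2 * d e / f u" using low[of y] fu by (simp add: field_simps)
    also have "\<dots> \<le> K" unfolding K_def
      by (rule member_le_sum) (use fu dpos in \<open>auto simp: less_imp_le\<close>)
    finally have "(norm y)^2 \<le> K" .
    moreover have "\<bar>y $ k\<bar>^2 \<le> (norm y)^2" by (intro power_mono component_le_norm_cart) auto
    ultimately have "\<bar>real_of_int (x k)\<bar>^2 \<le> K" by (simp add: y_def)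
    moreover have "\<bar>x k\<bar> \<le> \<bar>x k\<bar>^2"
      using mult_left_mono[of 1 "\<bar>x k\<bar>" "\<bar>x k\<bar>"]
      by (cases "x k = 0") (simp_all add: power2_eq_square)
    then have "\<bar>real_of_int (x k)\<bar> \<le> \<bar>real_of_int (x k)\<bar>^2"
      by (metis of_int_abs of_int_le_iff of_int_power)
    ultimately have "\<bar>real_of_int (x k)\<bar> \<le> K" by linarith
    then have "\<bar>x k\<bar> \<le> N" unfolding N_def by linarith
    then show ?thesis by auto
  qed
  then have "{x. root x} \<subseteq> (\<Pi>\<^sub>E k\<in>UNIV. {-N..N})" by (auto simp: PiE_def)
  then show ?thesis by (rule finite_subset) (simp add: finite_PiE)
qed

subsection \<open>The Euler form and the inverse of tau on parabolic subsystems\<close>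

definition supported :: "'i set \<Rightarrow> ('i \<Rightarrow> int) \<Rightarrow> bool" where
  "supported J x \<longleftrightarrow> (\<forall>k. k \<notin> J \<longrightarrow> x k = 0)"

lemma pairing_cong_supported:
  assumes "supported J x" "\<And>k. k \<in> J \<Longrightarrow> l k = m k"
  shows "pairing l x = pairing m x"
  unfolding pairing_def
proof (rule sum.cong)
  fix k
  show "d k * real_of_int (l k) * real_of_int (x k) = d k * real_of_int (m k) * real_of_int (x k)"
    using assms by (cases "k \<in> J") (auto simp: supported_def)
qed simp

lemma pairing_zero: "pairing (\<lambda>k. 0) x = 0"
  by (simp add: pairing_def)

lemma euler_zero_imp: "euler z z = 0 \<Longrightarrow> z = (\<lambda>k. 0)"
  using euler_pos[of z] by (metis less_irrefl)

text \<open>The difference \<open>z\<close> is supported on J and \<open>mv upp z\<close> vanishes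
  there, so \<open>euler z z\<close> = 0 and definiteness gives \<open>z\<close> = 0.\<close>

lemma upp_inj:
  assumes "supported J x" "supported J y" "\<And>k. k \<in> J \<Longrightarrow> mv upp x k = mv upp y k"
  shows "x = y"
proof -
  define z where "z = (\<lambda>k. x k - y k)"
  have "euler z z = pairing (\<lambda>k. 0) z"
    unfolding euler_upp
    by (rule pairing_cong_supported[of J]) (use assms in \<open>auto simp: z_def mv_diff supported_def\<close>)
  then have "z = (\<lambda>k. 0)" by (simp add: pairing_zero euler_zero_imp)
  then show ?thesis unfolding z_def by (metis eq_iff_diff_eq_0 ext)
qed

lemma low_inj:
  assumes "supported J x" "supported J y" "\<And>k. k \<in> J \<Longrightarrow> mv low x k = mv low y k"
  shows "x = y"
proof -
  define z where "z = (\<lambda>k. x k - y k)"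
  have "euler z z = pairing (\<lambda>k. 0) z"
    unfolding euler_def
    by (rule pairing_cong_supported[of J]) (use assms in \<open>auto simp: z_def mv_diff supported_def\<close>)
  then have "z = (\<lambda>k. 0)" by (simp add: pairing_zero euler_zero_imp)
  then show ?thesis unfolding z_def by (metis eq_iff_diff_eq_0 ext)
qed

lemma A_inj_supported:
  assumes "supported J x" "\<And>k. k \<in> J \<Longrightarrow> mv A x k = 0"
  shows "x = (\<lambda>k. 0)"
proof -
  have "pairing (mv A x) x = pairing (\<lambda>k. 0) x" by (rule pairing_cong_supported[of J]) (use assms in auto)
  then show ?thesis by (simp add: pairing_A pairing_zero euler_zero_imp)
qed

abbreviation rsorted :: "'i list \<Rightarrow> bool" where
  "rsorted \<equiv> sorted_wrt (\<lambda>i j. r i < r j)"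

lemma upp_after: "r j < r k \<Longrightarrow> upp k j = 0"
  by (auto simp: upp_def)

lemma upp_before: "r k < r j \<Longrightarrow> upp k j = A k j"
  by (auto simp: upp_def)

lemma low_before: "r k < r j \<Longrightarrow> low k j = 0"
  by (auto simp: low_def)

text \<open>Back substitution in the system \<open>upp\<close> y = l: a new first letter
  \<open>i\<close> only adds a multiple of the \<open>i\<close>-th unit vector, and column
  \<open>i\<close> of \<open>upp\<close> vanishes in the rows of all later letters.\<close>

lemma word_elt_upp:
  assumes "rsorted vs"
  shows "\<exists>y. supported (set vs) y \<and> (\<forall>k\<in>set vs. mv upp y k = l k) \<and>
    word_elt A vs l = (\<lambda>k. l k - mv A y k)"
  using assms
proof (induction vs)
  case Nil
  show ?case by (rule exI[of _ "\<lambda>k. 0"]) (auto simp: supported_def mv_def)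
next
  case (Cons i vs)
  then obtain y where y: "supported (set vs) y" "\<And>k. k \<in> set vs \<Longrightarrow> mv upp y k = l k"
    "word_elt A vs l = (\<lambda>k. l k - mv A y k)" by auto
  have before: "r i < r k" if "k \<in> set vs" for k using Cons.prems that by simp
  define m where "m = l i - mv A y i"
  define z where "z = (\<lambda>k. y k + m * fund_weight i k)"
  have mvz: "mv M z k = mv M y k + m * M k i" for M k
    by (simp add: z_def mv_add mv_scale mv_fund_weight)
  \<comment> \<open>\<open>y\<close> is supported on letters after \<open>i\<close>, where row
    \<open>i\<close> of \<open>upp\<close> agrees with row \<open>i\<close> of
    \<open>A\<close>.\<close>
  have "mv upp y i = mv A y i"
    unfolding mv_def
  proof (rule sum.cong)
    fix j show "upp i j * y j = A i j * y j"
      using y(1) before[of j] upp_before[of i j] by (cases "j \<in> set vs") (auto simp: supported_def)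
  qed simp
  then have "mv upp z i = l i" by (simp add: mvz m_def upp_def)
  moreover have "mv upp z k = l k" if "k \<in> set vs" for k
    using that before[of k] by (simp add: mvz y upp_after)
  moreover have "supported (set (i # vs)) z" using y(1) by (auto simp: supported_def z_def)
  moreover have "word_elt A (i # vs) l = (\<lambda>k. l k - mv A z k)"
    by (rule ext) (simp add: y(3) simple_refl_def mvz m_def algebra_simps)
  ultimately show ?case by (intro exI[of _ z]) auto
qed

text \<open>Prefixing a smaller letter \<open>j\<close> alters only coordinate \<open>j\<close> of
  the root. Among the letters of the word this affects row \<open>j\<close> of \<open>upp\<close>
  alone, and the amount subtracted clears that row.\<close>

lemma inversion_root:
  assumes "rsorted (us @ i # ts)"
  shows "supported (insert i (set us)) (root_word A us (fund_weight i)) \<and>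
    posroot (root_word A us (fund_weight i)) \<and>
    (\<forall>k\<in>set (us @ i # ts). mv upp (root_word A us (fund_weight i)) k = fund_weight i k)"
  using assms
proof (induction us)
  case Nil
  then have "mv upp (fund_weight i) k = fund_weight i k" if "k \<in> set (i # ts)" for k
    using that by (cases "k = i") (auto simp: mv_fund_weight upp_def)
  then show ?case by (auto simp: supported_def)
next
  case (Cons j us)
  define z where "z = root_word A us (fund_weight i)"
  have z: "supported (insert i (set us)) z" "posroot z"
    "\<And>k. k \<in> set (us @ i # ts) \<Longrightarrow> mv upp z k = fund_weight i k"
    using Cons by (auto simp: z_def)
  have before: "r j < r k" if "k \<in> set (us @ i # ts)" for k using Cons.prems that by auto
  then have j: "j \<notin> set (us @ i # ts)" by auto
  then have zj: "z j = 0" using z(1) by (auto simp: supported_def)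
  then have "z \<noteq> fund_weight j" by (metis fund_weight_simps(1) zero_neq_one)
  then have "posroot (root_refl A j z)" using z(2) posroot_refl by blast
  moreover have "supported (insert i (set (j # us))) (root_refl A j z)"
    using z(1) by (auto simp: supported_def)
  moreover have mvz: "mv M (root_refl A j z) k = mv M z k - mv A z j * M k j" for M k
    by (simp add: root_refl_def mv_diff mv_scale mv_fund_weight)
  have "mv upp (root_refl A j z) k = fund_weight i k" if "k \<in> set (us @ i # ts)" for k
    using that z(3) before[OF that] by (simp add: mvz upp_after)
  \<comment> \<open>\<open>z\<close> lives on letters after \<open>j\<close>, so
    \<open>mv A z j\<close> equals \<open>mv upp z j\<close>, which is what the reflection
    subtracts.\<close>
  moreover have "mv low z j = 0" unfolding mv_def
  proof (rule sum.neutral, rule ballI)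
    fix k show "low j k * z k = 0"
      using z(1) before[of k] low_before[of j k] by (cases "k \<in> set (us @ i # ts)") (auto simp: supported_def)
  qed
  then have "mv upp (root_refl A j z) j = fund_weight i j"
    using j by (simp add: mvz upp_def[of j j] mv_A[of z j])
  ultimately show ?case by (auto simp: z_def)
qed

text \<open>The letters of \<open>vs\<close> act from left to right, and by
  \<open>posroot_refl\<close> a positive root can lose positivity only at a letter \<open>i\<close>
  where it has become the simple root \<open>i\<close>.\<close>

lemma root_word_becomes_negative:
  assumes "posroot x" "\<not> posroot (root_word A (rev vs) x)"
  shows "\<exists>us i ts. vs = us @ i # ts \<and> x = root_word A us (fund_weight i)"
  using assms
proof (induction vs arbitrary: x)
  case Nil then show ?case by simp
next
  case (Cons i vs)
  show ?case
  proof (cases "x = fund_weight i")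
    case True
    then show ?thesis by (intro exI[of _ "[]"] exI[of _ i] exI[of _ vs]) simp
  next
    case False
    then have "posroot (root_refl A i x)" using Cons.prems posroot_refl by blast
    moreover have "\<not> posroot (root_word A (rev vs) (root_refl A i x))" using Cons.prems by simp
    ultimately obtain us k ts where "vs = us @ k # ts" "root_refl A i x = root_word A us (fund_weight k)"
      using Cons.IH by blast
    then show ?thesis
      by (intro exI[of _ "i # us"] exI[of _ k] exI[of _ ts]) (simp, metis root_refl_invol)
  qed
qed

section \<open>Coxeter elements of parabolic subsystems\<close>

definition subword :: "'i set \<Rightarrow> 'i list" where "subword J = filter (\<lambda>i. i \<in> J) ws"

definition cox_root :: "'i set \<Rightarrow> ('i \<Rightarrow> int) \<Rightarrow> 'i \<Rightarrow> int" where "cox_root J = root_word A (subword J)"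

definition cox_root_inv :: "'i set \<Rightarrow> ('i \<Rightarrow> int) \<Rightarrow> 'i \<Rightarrow> int" where "cox_root_inv J = root_word A (rev (subword J))"

lemma subword_sorted [simp]: "rsorted (subword J)" and set_subword [simp]: "set (subword J) = J"
  using ws_sorted ws_all by (auto simp: subword_def sorted_wrt_filter)

lemma cox_root_cox_root_inv [simp]: "cox_root J (cox_root_inv J x) = x" "cox_root_inv J (cox_root J x) = x"
  by (simp_all add: cox_root_def cox_root_inv_def)

lemma supported_root_word: "set vs \<subseteq> J \<Longrightarrow> supported J x \<Longrightarrow> supported J (root_word A vs x)"
proof (induction vs)
  case (Cons i vs)
  then have "supported J (root_word A vs x)" "i \<in> J" by auto
  then show ?case unfolding supported_def root_word_simps by (metis root_refl_other)
qed simp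

lemma supported_cox_root [simp]: "supported J x \<Longrightarrow> supported J (cox_root J x)"
  and supported_cox_root_inv [simp]: "supported J x \<Longrightarrow> supported J (cox_root_inv J x)"
  by (auto simp: cox_root_def cox_root_inv_def intro: supported_root_word)

lemma supported_minus [simp]: "supported J (\<lambda>k. - x k) = supported J x"
  by (simp add: supported_def)

lemma root_cox_root [simp]: "root x \<Longrightarrow> root (cox_root J x)" and root_cox_root_inv [simp]: "root x \<Longrightarrow> root (cox_root_inv J x)"
  by (simp_all add: cox_root_def cox_root_inv_def root_word_root)

lemma cox_root_minus: "cox_root J (\<lambda>k. - x k) = (\<lambda>k. - cox_root J x k)"
  and cox_root_inv_minus: "cox_root_inv J (\<lambda>k. - x k) = (\<lambda>k. - cox_root_inv J x k)"
  by (simp_all add: cox_root_def cox_root_inv_def root_word_minus)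

text \<open>By \<open>word_elt_upp\<close> for the weight A x, c x = x - y with \<open>upp\<close> y
  = A x = \<open>low\<close> x + \<open>upp\<close> x on J.\<close>

lemma upp_cox_root:
  assumes "supported J x" "k \<in> J"
  shows "mv upp (cox_root J x) k = - mv low x k"
proof -
  obtain y where y: "supported J y" "\<And>k. k \<in> J \<Longrightarrow> mv upp y k = mv A x k"
    "word_elt A (subword J) (mv A x) = (\<lambda>k. mv A x k - mv A y k)"
    using word_elt_upp[of "subword J" "mv A x"] by auto
  have "mv A (cox_root J x) = mv A (\<lambda>k. x k - y k)"
    by (rule ext) (simp add: cox_root_def mv_root_word y(3) mv_diff)
  then have "cox_root J x = (\<lambda>k. x k - y k)" by (rule mv_A_inj)
  then show ?thesis using y(2)[OF assms(2)] by (simp add: mv_diff mv_A)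
qed

lemma low_cox_root_inv: "supported J x \<Longrightarrow> k \<in> J \<Longrightarrow> mv low (cox_root_inv J x) k = - mv upp x k"
  using upp_cox_root[of J "cox_root_inv J x" k] by simp

lemma inversion_root_subword:
  assumes "subword J = us @ i # ts"
  shows "i \<in> J" "supported J (root_word A us (fund_weight i))"
    "posroot (root_word A us (fund_weight i))"
    "\<And>k. k \<in> J \<Longrightarrow> mv upp (root_word A us (fund_weight i)) k = fund_weight i k"
proof -
  have "rsorted (us @ i # ts)" using subword_sorted[of J] assms by metis
  moreover have J: "set (us @ i # ts) = J" using set_subword[of J] assms by simp
  ultimately show "i \<in> J" "supported J (root_word A us (fund_weight i))"
    "posroot (root_word A us (fund_weight i))"
    "\<And>k. k \<in> J \<Longrightarrow> mv upp (root_word A us (fund_weight i)) k = fund_weight i k"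
    using inversion_root[of us i ts] by (auto simp: supported_def)
qed

text \<open>\<open>upp_root J i\<close> and \<open>low_root J i\<close> are the roots \<open>x\<close> representing \<open>c \<omega>\<^sub>i\<close> and \<open>- \<omega>\<^sub>i\<close> in the form
  \<open>- low x\<close>, for the parabolic subsystem of \<open>J\<close>.\<close>

definition upp_root :: "'i set \<Rightarrow> 'i \<Rightarrow> 'i \<Rightarrow> int" where
  "upp_root J i = (SOME z. supported J z \<and> posroot z \<and> (\<forall>k\<in>J. mv upp z k = fund_weight i k))"

lemma upp_root:
  assumes "i \<in> J"
  shows supported_upp_root [simp]: "supported J (upp_root J i)" and posroot_upp_root [simp]: "posroot (upp_root J i)"
    and upp_upp_root: "\<And>k. k \<in> J \<Longrightarrow> mv upp (upp_root J i) k = fund_weight i k"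
proof -
  from assms have "i \<in> set (subword J)" by simp
  then obtain us ts where s: "subword J = us @ i # ts" by (metis split_list)
  then have "supported J (root_word A us (fund_weight i)) \<and> posroot (root_word A us (fund_weight i)) \<and>
    (\<forall>k\<in>J. mv upp (root_word A us (fund_weight i)) k = fund_weight i k)"
    using inversion_root_subword by blast
  then have "supported J (upp_root J i) \<and> posroot (upp_root J i) \<and> (\<forall>k\<in>J. mv upp (upp_root J i) k = fund_weight i k)"
    unfolding upp_root_def
    by (rule someI[where P = "\<lambda>z. supported J z \<and> posroot z \<and> (\<forall>k\<in>J. mv upp z k = fund_weight i k)"])
  then show "supported J (upp_root J i)" "posroot (upp_root J i)" "\<And>k. k \<in> J \<Longrightarrow> mv upp (upp_root J i) k = fund_weight i k"
    by auto
qed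

lemma upp_root_unique: "i \<in> J \<Longrightarrow> supported J z \<Longrightarrow> (\<And>k. k \<in> J \<Longrightarrow> mv upp z k = fund_weight i k) \<Longrightarrow> z = upp_root J i"
  by (rule upp_inj[of J]) (auto simp: upp_upp_root)

lemma upp_root_inj: "i \<in> J \<Longrightarrow> j \<in> J \<Longrightarrow> upp_root J i = upp_root J j \<Longrightarrow> i = j"
  by (metis fund_weight_simps upp_upp_root zero_neq_one)

text \<open>Positivity is lost only at the root of a prefix of the word, and the equations for
  \<open>upp\<close> identify this root with \<open>upp_root J i\<close>.\<close>

lemma cox_root_inv_negative:
  assumes "posroot x" "\<not> posroot (cox_root_inv J x)"
  obtains i where "i \<in> J" "x = upp_root J i"
proof -
  obtain us i ts where s: "subword J = us @ i # ts" "x = root_word A us (fund_weight i)"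
    using root_word_becomes_negative[of x "subword J"] assms unfolding cox_root_inv_def by auto
  have "x = upp_root J i"
    unfolding s(2) by (rule upp_root_unique) (use inversion_root_subword[OF s(1)] in auto)
  then show ?thesis using that inversion_root_subword(1)[OF s(1)] by blast
qed

definition low_root :: "'i set \<Rightarrow> 'i \<Rightarrow> 'i \<Rightarrow> int" where
  "low_root J i = (\<lambda>k. - cox_root_inv J (upp_root J i) k)"

lemma low_root:
  assumes i: "i \<in> J"
  shows supported_low_root [simp]: "supported J (low_root J i)"
    and low_low_root: "\<And>k. k \<in> J \<Longrightarrow> mv low (low_root J i) k = fund_weight i k"
    and cox_root_low_root: "cox_root J (low_root J i) = (\<lambda>k. - upp_root J i k)"
    and euler_low_root: "\<And>y. supported J y \<Longrightarrow> euler y (low_root J i) = d i * y i"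
    and posroot_low_root [simp]: "posroot (low_root J i)"
proof -
  show s: "supported J (low_root J i)" using i by (simp add: low_root_def)
  show l: "mv low (low_root J i) k = fund_weight i k" if "k \<in> J" for k
    using i that by (simp add: low_root_def mv_minus low_cox_root_inv upp_upp_root)
  show "cox_root J (low_root J i) = (\<lambda>k. - upp_root J i k)" by (simp add: low_root_def cox_root_minus)
  show e: "euler y (low_root J i) = d i * y i" if "supported J y" for y
  proof -
    have "euler y (low_root J i) = pairing (fund_weight i) y"
      unfolding euler_def by (rule pairing_cong_supported[OF that]) (rule l)
    then show ?thesis by (simp add: pairing_fund_weight_left)
  qed
  have r: "root (low_root J i)" using i by (simp add: low_root_def posroot_upp_root[unfolded posroot_def])
  obtain k where "low_root J i k \<noteq> 0" using root_nonzero[OF r] .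
  \<comment> \<open>For this root the length itself equals \<open>d i\<close> times coordinate
    \<open>i\<close>, so that coordinate is positive, and one positive coordinate makes a root
    positive.\<close>
  then have "d i * low_root J i i > 0" using euler_pos[of "low_root J i" k] e[OF s] by simp
  then have "low_root J i i > 0" using dpos[of i] by (simp add: zero_less_mult_iff)
  then show "posroot (low_root J i)" using posrootI r by blast
qed

lemma low_root_inj: "i \<in> J \<Longrightarrow> j \<in> J \<Longrightarrow> low_root J i = low_root J j \<Longrightarrow> i = j"
  by (metis fund_weight_simps low_low_root zero_neq_one)

lemma euler_upp_root: assumes "i \<in> J" "supported J y" shows "euler (upp_root J i) y = d i * y i"
proof -
  have "euler (upp_root J i) y = pairing (fund_weight i) y"
    unfolding euler_upp by (rule pairing_cong_supported[OF assms(2)]) (rule upp_upp_root[OF assms(1)])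
  then show ?thesis by (simp add: pairing_fund_weight_left)
qed

text \<open>The left side is computed through \<open>euler_upp\<close>, and \<open>upp\<close> (c x)
  = -\<open>low\<close> x on J. Used twice, this gives invariance of the Euler form under the
  Coxeter element.\<close>

lemma euler_cox_root: assumes "supported J x" "supported J y" shows "euler (cox_root J x) y = - euler y x"
proof -
  have "euler (cox_root J x) y = pairing (\<lambda>k. - mv low x k) y"
    unfolding euler_upp by (rule pairing_cong_supported[OF assms(2)]) (rule upp_cox_root[OF assms(1)])
  then show ?thesis by (simp add: pairing_minus euler_def)
qed

lemma euler_cox_root_inv: "supported J x \<Longrightarrow> supported J y \<Longrightarrow> euler x y = - euler y (cox_root_inv J x)"
  using euler_cox_root[of J "cox_root_inv J x" y] by simp

lemma euler_cox_root_inv_cox_root_inv: "supported J x \<Longrightarrow> supported J y \<Longrightarrow> euler (cox_root_inv J x) (cox_root_inv J y) = euler x y"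
  using euler_cox_root_inv[of J x y] euler_cox_root_inv[of J y "cox_root_inv J x"] by simp

lemma cox_root_inv_positive:
  assumes "posroot x" "\<And>i. i \<in> J \<Longrightarrow> x \<noteq> upp_root J i"
  shows "posroot (cox_root_inv J x)"
  using cox_root_inv_negative[OF assms(1), of J] assms(2) by blast

text \<open>If c x were negative, c^-1 would send the positive root -c x to the negative root -x, so
  -c x would be some \<open>upp_root J i\<close>, and x would be
  \<open>low_root J i\<close>.\<close>

lemma cox_root_positive:
  assumes "posroot x" "supported J x" "\<And>i. i \<in> J \<Longrightarrow> x \<noteq> low_root J i"
  shows "posroot (cox_root J x)"
proof (rule ccontr)
  assume "\<not> posroot (cox_root J x)"
  then have p: "posroot (\<lambda>k. - cox_root J x k)"
    using root_sign[of "cox_root J x"] assms(1) by (auto simp: posroot_def)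
  have "cox_root_inv J (\<lambda>k. - cox_root J x k) = (\<lambda>k. - x k)" by (simp add: cox_root_inv_minus)
  then have "\<not> posroot (cox_root_inv J (\<lambda>k. - cox_root J x k))" using not_posroot_both[OF assms(1)] by simp
  with p obtain i where i: "i \<in> J" "(\<lambda>k. - cox_root J x k) = upp_root J i" using cox_root_inv_negative by metis
  have "cox_root J x = (\<lambda>k. - upp_root J i k)"
  proof
    fix k show "cox_root J x k = - upp_root J i k" using fun_cong[OF i(2), of k] by simp
  qed
  then have "cox_root J x = cox_root J (low_root J i)" using i by (simp add: cox_root_low_root)
  then have "x = low_root J i" by (metis cox_root_cox_root_inv(2))
  with i assms(3) show False by blast
qed


section \<open>Vertices, the inverse of tau and its invariants\<close>

text \<open>\<open>Inl i\<close> stands for the weight \<open>\<omega>\<^sub>i\<close> and \<open>Inr x\<close> for the weight \<open>- low x\<close>.\<close>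

definition vtx :: "'i set \<Rightarrow> ('i + ('i \<Rightarrow> int)) set" where
  "vtx J = Inl ` J \<union> Inr ` {x. posroot x \<and> supported J x}"

lemma vtx_simps [simp]: "Inl i \<in> vtx J \<longleftrightarrow> i \<in> J" "Inr x \<in> vtx J \<longleftrightarrow> posroot x \<and> supported J x"
  by (auto simp: vtx_def)

lemma finite_vtx [simp]: "finite (vtx J)"
  unfolding vtx_def by (auto intro: finite_subset[OF _ finite_roots] simp: posroot_def)

text \<open>The inverse of \<open>\<tau>\<close> for the parabolic subsystem of \<open>J\<close>.\<close>

definition tau_inv :: "'i set \<Rightarrow> 'i + ('i \<Rightarrow> int) \<Rightarrow> 'i + ('i \<Rightarrow> int)" where
  "tau_inv J t = (case t of Inl i \<Rightarrow> Inr (low_root J i)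
     | Inr x \<Rightarrow> if \<exists>i\<in>J. x = upp_root J i then Inl (THE i. i \<in> J \<and> x = upp_root J i) else Inr (cox_root_inv J x))"

lemma tau_inv_Inl [simp]: "tau_inv J (Inl i) = Inr (low_root J i)"
  by (simp add: tau_inv_def)

lemma tau_inv_upp_root [simp]: "i \<in> J \<Longrightarrow> tau_inv J (Inr (upp_root J i)) = Inl i"
  unfolding tau_inv_def by (auto intro!: the_equality dest: upp_root_inj)

lemma tau_inv_other: "(\<And>i. i \<in> J \<Longrightarrow> x \<noteq> upp_root J i) \<Longrightarrow> tau_inv J (Inr x) = Inr (cox_root_inv J x)"
  unfolding tau_inv_def by auto

lemma vtx_cases:
  assumes "t \<in> vtx J"
  obtains (Inl) i where "i \<in> J" "t = Inl i"
  | (upp_root) i where "i \<in> J" "t = Inr (upp_root J i)"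
  | (other) x where "posroot x" "supported J x" "\<And>i. i \<in> J \<Longrightarrow> x \<noteq> upp_root J i" "t = Inr x"
  using assms unfolding vtx_def by blast

lemma tau_inv_in [simp]: assumes "t \<in> vtx J" shows "tau_inv J t \<in> vtx J"
  using assms by (cases rule: vtx_cases) (auto simp: tau_inv_other cox_root_inv_positive)

lemma low_root_ne_cox_root_inv: assumes "i \<in> J" "posroot x" shows "low_root J i \<noteq> cox_root_inv J x"
proof
  assume "low_root J i = cox_root_inv J x"
  then have "x = cox_root J (low_root J i)" by simp
  then have "x = (\<lambda>k. - upp_root J i k)" by (simp add: cox_root_low_root assms)
  then show False using assms not_posroot_both[OF posroot_upp_root[of i J]] by simp
qed

lemma tau_inv_inj: "inj_on (tau_inv J) (vtx J)"
proof (rule inj_onI)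
  fix s t assume s: "s \<in> vtx J" and t: "t \<in> vtx J" and eq: "tau_inv J s = tau_inv J t"
  from s show "s = t"
  proof (cases rule: vtx_cases)
    case Inl_s: (Inl i)
    from t show ?thesis
    proof (cases rule: vtx_cases)
      case (Inl j)
      then have "low_root J i = low_root J j" using Inl_s eq by simp
      then show ?thesis using Inl Inl_s low_root_inj by blast
    next
      case (upp_root j)
      then show ?thesis using Inl_s eq by simp
    next
      case (other y)
      then have "low_root J i = cox_root_inv J y" using Inl_s eq by (simp add: tau_inv_other)
      then show ?thesis using low_root_ne_cox_root_inv Inl_s other by blast
    qed
  next
    case upp_root_s: (upp_root i)
    from t show ?thesis
    proof (cases rule: vtx_cases)
      case (other y)
      then show ?thesis using upp_root_s eq by (simp add: tau_inv_other)
    qed (use upp_root_s eq in simp_all)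
  next
    case other_s: (other x)
    from t show ?thesis
    proof (cases rule: vtx_cases)
      case (Inl j)
      then have "low_root J j = cox_root_inv J x" using other_s eq by (simp add: tau_inv_other)
      then show ?thesis using low_root_ne_cox_root_inv other_s Inl by blast
    next
      case (upp_root j)
      then show ?thesis using other_s eq by (simp add: tau_inv_other)
    next
      case (other y)
      then have "cox_root_inv J x = cox_root_inv J y" using other_s eq by (simp add: tau_inv_other)
      then have "x = y" by (metis cox_root_cox_root_inv(1))
      then show ?thesis using other other_s by simp
    qed
  qed
qed

lemma tau_inv_bij: "bij_betw (tau_inv J) (vtx J) (vtx J)"
  using endo_inj_surj[OF finite_vtx _ tau_inv_inj] tau_inv_inj tau_inv_in
  by (metis bij_betw_def image_subsetI)

text \<open>The compatibility degree \<open>(s || t)\<close> multiplied by \<open>vtx_norm s\<close>, which makes it symmetric.\<close>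

fun scaled_degree :: "'i + ('i \<Rightarrow> int) \<Rightarrow> 'i + ('i \<Rightarrow> int) \<Rightarrow> real" where
  "scaled_degree (Inl i) (Inl j) = 0"
| "scaled_degree (Inl i) (Inr y) = d i * y i"
| "scaled_degree (Inr x) (Inl j) = d j * x j"
| "scaled_degree (Inr x) (Inr y) = max 0 (- euler x y) + max 0 (- euler y x)"

text \<open>Half the squared length of a root. \<open>Inl i\<close> receives \<open>d i\<close>, the
  value at its image \<open>low_root J i\<close>, so that the function is constant along
  \<open>tau_inv\<close>.\<close>

fun vtx_norm :: "'i + ('i \<Rightarrow> int) \<Rightarrow> real" where
  "vtx_norm (Inl i) = d i"
| "vtx_norm (Inr x) = euler x x"

lemma scaled_degree_sym: "scaled_degree s t = scaled_degree t s"
  by (cases s; cases t) auto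

lemma posroot_nonneg: "posroot x \<Longrightarrow> 0 \<le> d i * real_of_int (x i)"
  using dpos[of i] by (simp add: posroot_def)

lemma vtx_norm_pos: "t \<in> vtx J \<Longrightarrow> vtx_norm t > 0"
  using dpos by (cases t) (auto simp: posroot_def elim!: root_nonzero intro: euler_pos)

lemma euler_root_word_fund: "euler (root_word A us (fund_weight i)) (root_word A us (fund_weight i)) = d i"
  by (simp add: euler_word euler_fund_weight)

text \<open>\<open>upp_root J i\<close> was chosen by its equations; their uniqueness exhibits it as
  a Weyl group image of the simple root \<open>i\<close>, whose length is known.\<close>

lemma euler_upp_root_self: assumes "i \<in> J" shows "euler (upp_root J i) (upp_root J i) = d i"
proof -
  from assms have "i \<in> set (subword J)" by simp
  then obtain us ts where s: "subword J = us @ i # ts" by (metis split_list)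
  have "root_word A us (fund_weight i) = upp_root J i"
    by (rule upp_root_unique) (use inversion_root_subword[OF s] in auto)
  then show ?thesis by (metis euler_root_word_fund)
qed

lemma euler_low_root_self: assumes "i \<in> J" shows "euler (low_root J i) (low_root J i) = d i"
proof -
  have "euler (low_root J i) (low_root J i) = euler (cox_root J (low_root J i)) (cox_root J (low_root J i))"
    by (simp add: cox_root_def euler_word)
  also have "cox_root J (low_root J i) = (\<lambda>k. - upp_root J i k)" by (rule cox_root_low_root[OF assms])
  also have "mv low (\<lambda>k. - upp_root J i k) = (\<lambda>k. - mv low (upp_root J i) k)" by (rule ext) (rule mv_minus)
  then have "euler (\<lambda>k. - upp_root J i k) (\<lambda>k. - upp_root J i k) = euler (upp_root J i) (upp_root J i)"
    by (simp add: euler_def pairing_minus pairing_minus_right)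
  finally show ?thesis by (simp add: euler_upp_root_self assms)
qed

lemma vtx_norm_tau_inv: assumes "t \<in> vtx J" shows "vtx_norm (tau_inv J t) = vtx_norm t"
  using assms
  by (cases rule: vtx_cases) (auto simp: euler_low_root_self euler_upp_root_self tau_inv_other cox_root_inv_def euler_word)

text \<open>For two roots that stay roots this is the invariance of the Euler form. Otherwise Euler
  forms with \<open>low_root\<close> or \<open>upp_root\<close> are coordinates times
  \<open>d\<close>: those of the wrong sign are cut off by the maximum, and what remains is the
  required coordinate.\<close>

lemma scaled_degree_tau_inv:
  assumes s: "s \<in> vtx J" and t: "t \<in> vtx J"
  shows "scaled_degree (tau_inv J s) (tau_inv J t) = scaled_degree s t"
proof -
  have inl: "scaled_degree (tau_inv J (Inl i)) (tau_inv J t) = scaled_degree (Inl i) t" if i: "i \<in> J" and t: "t \<in> vtx J" for i t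
    using t
  proof (cases rule: vtx_cases)
    case (Inl j)
    then show ?thesis using i posroot_nonneg[of "low_root J i" j] posroot_nonneg[of "low_root J j" i]
      by (auto simp: euler_low_root max_def)
  next
    case (upp_root j)
    \<comment> \<open>Both sides compute \<open>euler (upp_root J j) (low_root J i)\<close>.\<close>
    have "d j * low_root J i j = d i * upp_root J j i"
      using euler_upp_root[of j J "low_root J i"] euler_low_root[of i J "upp_root J j"] upp_root i by simp
    then show ?thesis using upp_root by simp
  next
    case (other y)
    have "euler (cox_root_inv J y) (low_root J i) = d i * cox_root_inv J y i" using i other by (simp add: euler_low_root)
    moreover have "0 \<le> d i * real_of_int (cox_root_inv J y i)" using other cox_root_inv_positive posroot_nonneg by blast
    moreover have "- euler (low_root J i) (cox_root_inv J y) = euler y (low_root J i)" using other i euler_cox_root_inv[of J y "low_root J i"] by simp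
    moreover have "euler y (low_root J i) = d i * y i" using i other by (simp add: euler_low_root)
    moreover have "0 \<le> d i * real_of_int (y i)" using other posroot_nonneg by blast
    ultimately show ?thesis using other by (simp add: tau_inv_other)
  qed
  have upp_root: "scaled_degree (tau_inv J (Inr (upp_root J i))) (tau_inv J (Inr y)) = scaled_degree (Inr (upp_root J i)) (Inr y)"
    if i: "i \<in> J" and y: "Inr y \<in> vtx J" for i y
    using y
  proof (cases rule: vtx_cases)
    case (upp_root j)
    then show ?thesis using i posroot_nonneg[of "upp_root J i" j] posroot_nonneg[of "upp_root J j" i]
      by (auto simp: euler_upp_root max_def)
  next
    case (other y')
    then have y: "posroot y" "supported J y" "\<And>i. i \<in> J \<Longrightarrow> y \<noteq> upp_root J i" by auto
    have "euler (upp_root J i) y = d i * y i" using i y by (simp add: euler_upp_root)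
    moreover have "0 \<le> d i * real_of_int (y i)" using y posroot_nonneg by blast
    moreover have "- euler y (upp_root J i) = d i * cox_root_inv J y i"
      using i y by (simp add: euler_cox_root_inv[of J y "upp_root J i"] euler_upp_root)
    moreover have "0 \<le> d i * real_of_int (cox_root_inv J y i)" using y cox_root_inv_positive posroot_nonneg by blast
    ultimately show ?thesis using i y by (simp add: tau_inv_other)
  qed simp
  show ?thesis
  proof (cases s)
    case (Inl i) then show ?thesis using inl s t by auto
  next
    case (Inr x)
    show ?thesis
    proof (cases t)
      fix j assume "t = Inl j" then show ?thesis using inl[of j s] s t by (metis scaled_degree_sym vtx_simps(1))
    next
      fix y assume ty: "t = Inr y"
      show ?thesis
      proof (cases "\<exists>i\<in>J. x = upp_root J i")
        case True then show ?thesis using upp_root[of _ y] Inr ty t by auto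
      next
        case nx: False
        show ?thesis
        proof (cases "\<exists>i\<in>J. y = upp_root J i")
          case True then show ?thesis using upp_root[of _ x] Inr ty s by (metis scaled_degree_sym)
        next
          case False
          then show ?thesis using nx Inr ty s t by (simp add: tau_inv_other euler_cox_root_inv_cox_root_inv)
        qed
      qed
    qed
  qed
qed

subsection \<open>Clusters in parabolic subsystems\<close>

fun vtx_weight :: "'i + ('i \<Rightarrow> int) \<Rightarrow> 'i \<Rightarrow> int" where
  "vtx_weight (Inl i) = fund_weight i"
| "vtx_weight (Inr x) = (\<lambda>k. - mv low x k)"

text \<open>A basis of the lattice Z^J. Coordinates outside J are ignored, because
  -\<open>low\<close> x may be nonzero there even when x is supported in J.\<close>

definition zbasis :: "'i set \<Rightarrow> ('i + ('i \<Rightarrow> int)) set \<Rightarrow> bool" where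
  "zbasis J S \<longleftrightarrow> finite S \<and>
     (\<forall>v :: 'i \<Rightarrow> int. \<exists>a :: 'i + ('i \<Rightarrow> int) \<Rightarrow> int. \<forall>k\<in>J. v k = (\<Sum>t\<in>S. a t * vtx_weight t k)) \<and>
     (\<forall>a :: 'i + ('i \<Rightarrow> int) \<Rightarrow> int. (\<forall>k\<in>J. (\<Sum>t\<in>S. a t * vtx_weight t k) = 0) \<longrightarrow> (\<forall>t\<in>S. a t = 0))"

lemma zbasis_span:
  assumes "zbasis J S"
  obtains a :: "'i + ('i \<Rightarrow> int) \<Rightarrow> int" where "\<And>k. k \<in> J \<Longrightarrow> v k = (\<Sum>t\<in>S. a t * vtx_weight t k)"
  using assms unfolding zbasis_def by metis

lemma zbasis_indep:
  fixes a :: "'i + ('i \<Rightarrow> int) \<Rightarrow> int"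
  assumes "zbasis J S" "\<And>k. k \<in> J \<Longrightarrow> (\<Sum>t\<in>S. a t * vtx_weight t k) = 0" "t \<in> S"
  shows "a t = 0"
  using assms unfolding zbasis_def by metis

text \<open>omega_i is 1 at \<open>i\<close> and 0 on \<open>J - {i}\<close>, so the matrix is block
  triangular: \<open>J - {i}\<close> fixes the coefficients on \<open>S\<close>, and coordinate
  \<open>i\<close> then fixes that of omega_i.\<close>

lemma zbasis_insert_Inl:
  assumes b: "zbasis (J - {i}) S" and i: "i \<in> J" and n: "Inl i \<notin> S"
  shows "zbasis J (insert (Inl i) S)"
proof -
  have fin: "finite S" using b by (simp add: zbasis_def)
  have sum: "(\<Sum>t\<in>insert (Inl i) S. a t * vtx_weight t k) = a (Inl i) * fund_weight i k + (\<Sum>t\<in>S. a t * vtx_weight t k)"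
    for a :: "'i + ('i \<Rightarrow> int) \<Rightarrow> int" and k
    using fin n by simp
  have "\<exists>a. \<forall>k\<in>J. v k = (\<Sum>t\<in>insert (Inl i) S. a t * vtx_weight t k)" for v :: "'i \<Rightarrow> int"
  proof -
    obtain a where a: "\<And>k. k \<in> J - {i} \<Longrightarrow> v k = (\<Sum>t\<in>S. a t * vtx_weight t k)"
      using zbasis_span[OF b, of v] by blast
    define a' where "a' = a(Inl i := v i - (\<Sum>t\<in>S. a t * vtx_weight t i))"
    have "(\<Sum>t\<in>S. a' t * vtx_weight t k) = (\<Sum>t\<in>S. a t * vtx_weight t k)" for k
      by (rule sum.cong) (use n in \<open>auto simp: a'_def\<close>)
    then have "v k = (\<Sum>t\<in>insert (Inl i) S. a' t * vtx_weight t k)" if "k \<in> J" for k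
      unfolding sum using a[of k] that by (cases "k = i") (simp_all add: a'_def)
    then show ?thesis by blast
  qed
  moreover have "\<forall>t\<in>insert (Inl i) S. a t = 0"
    if a: "\<forall>k\<in>J. (\<Sum>t\<in>insert (Inl i) S. a t * vtx_weight t k) = 0" for a :: "'i + ('i \<Rightarrow> int) \<Rightarrow> int"
  proof -
    have "(\<Sum>t\<in>S. a t * vtx_weight t k) = 0" if "k \<in> J - {i}" for k
      using a that unfolding sum by auto
    then have S: "\<forall>t\<in>S. a t = 0" using zbasis_indep[OF b] by blast
    then have "(\<Sum>t\<in>S. a t * vtx_weight t i) = 0" by simp
    then have "a (Inl i) = 0" using a i unfolding sum by auto
    with S show ?thesis by simp
  qed
  ultimately show ?thesis using fin unfolding zbasis_def by blast
qed

lemma word_elt_cong_supported: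
  assumes "set vs \<subseteq> J" "\<And>k. k \<in> J \<Longrightarrow> l k = m k" "k \<in> J"
  shows "word_elt A vs l k = word_elt A vs m k"
  using assms by (induction vs arbitrary: k) (simp_all add: simple_refl_def)

lemma word_elt_low:
  assumes z: "supported J z" and l: "\<And>k. k \<in> J \<Longrightarrow> l k = mv upp z k" and k: "k \<in> J"
  shows "word_elt A (subword J) l k = - mv low z k"
proof -
  obtain y where y: "supported J y" "\<And>k. k \<in> J \<Longrightarrow> mv upp y k = l k"
    "word_elt A (subword J) l = (\<lambda>k. l k - mv A y k)"
    using word_elt_upp[of "subword J" l] by auto
  have "y = z" by (rule upp_inj[of J]) (use y z l in auto)
  then show ?thesis using y l[OF k] by (simp add: mv_A)
qed

lemma vtx_weight_tau_inv_Inr: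
  assumes t: "Inr x \<in> vtx J" and k: "k \<in> J"
  shows "vtx_weight (tau_inv J (Inr x)) k = mv upp x k"
  using t
proof (cases rule: vtx_cases)
  case (upp_root i) then show ?thesis using k by (simp add: upp_upp_root)
next
  case (other y) then show ?thesis using k by (simp add: tau_inv_other low_cox_root_inv)
qed simp

text \<open>Both branches of \<open>tau_inv\<close> on roots are covered: on J the image has weight
  \<open>upp\<close> x, also when it is a fundamental weight, and the Coxeter element of J maps this
  to -\<open>low\<close> x.\<close>

lemma vtx_weight_tau_inv:
  assumes t: "Inr x \<in> vtx J" and k: "k \<in> J"
  shows "word_elt A (subword J) (vtx_weight (tau_inv J (Inr x))) k = vtx_weight (Inr x) k"
  using word_elt_low[of J x "vtx_weight (tau_inv J (Inr x))" k] vtx_weight_tau_inv_Inr[OF t] t k by simp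

text \<open>The Coxeter word of J is an automorphism of Z^J with the reversed word as inverse.
  Without fundamental weights in \<open>S\<close> it maps the weight of \<open>tau_inv J t\<close>
  to that of \<open>t\<close> for every \<open>t\<close> in \<open>S\<close>.\<close>

lemma zbasis_tau_inv:
  assumes b: "zbasis J (tau_inv J ` S)" and S: "S \<subseteq> vtx J" and n: "\<And>i. Inl i \<notin> S"
  shows "zbasis J S"
proof -
  have inj: "inj_on (tau_inv J) S" using tau_inv_inj S by (rule inj_on_subset)
  have fin: "finite S" using S finite_vtx by (rule finite_subset)
  have w: "word_elt A (subword J) (vtx_weight (tau_inv J t)) k = vtx_weight t k" if "t \<in> S" "k \<in> J" for t k
    using that vtx_weight_tau_inv S n by (cases t) auto
  have W: "word_elt A (subword J) (\<lambda>k. \<Sum>t\<in>S. a t * vtx_weight (tau_inv J t) k) k = (\<Sum>t\<in>S. a t * vtx_weight t k)"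
    if "k \<in> J" for a k
    unfolding word_elt_sum by (rule sum.cong) (use w that in auto)
  have "\<exists>a. \<forall>k\<in>J. v k = (\<Sum>t\<in>S. a t * vtx_weight t k)" for v :: "'i \<Rightarrow> int"
  proof -
    obtain a where a: "\<And>k. k \<in> J \<Longrightarrow> word_elt A (rev (subword J)) v k = (\<Sum>t\<in>tau_inv J ` S. a t * vtx_weight t k)"
      using zbasis_span[OF b, of "word_elt A (rev (subword J)) v"] by blast
    have "v k = (\<Sum>t\<in>S. a (tau_inv J t) * vtx_weight t k)" if k: "k \<in> J" for k
    proof -
      have "v k = word_elt A (subword J) (word_elt A (rev (subword J)) v) k" by simp
      also have "\<dots> = word_elt A (subword J) (\<lambda>k. \<Sum>t\<in>S. a (tau_inv J t) * vtx_weight (tau_inv J t) k) k"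
        by (rule word_elt_cong_supported[of _ J]) (use k a inj in \<open>auto simp: sum.reindex\<close>)
      also have "\<dots> = (\<Sum>t\<in>S. a (tau_inv J t) * vtx_weight t k)" using k by (rule W)
      finally show ?thesis .
    qed
    then show ?thesis by (intro exI[of _ "\<lambda>t. a (tau_inv J t)"]) blast
  qed
  moreover have "\<forall>t\<in>S. a t = 0"
    if a: "\<forall>k\<in>J. (\<Sum>t\<in>S. a t * vtx_weight t k) = 0" for a :: "'i + ('i \<Rightarrow> int) \<Rightarrow> int"
  proof -
    define g where "g = the_inv_into S (tau_inv J)"
    have g: "g (tau_inv J t) = t" if "t \<in> S" for t
      unfolding g_def using the_inv_into_f_f[OF inj that] .
    define N where "N = (\<lambda>k. \<Sum>t\<in>S. a t * vtx_weight (tau_inv J t) k)"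
    have "N k = 0" if k: "k \<in> J" for k
    proof -
      have "N k = word_elt A (rev (subword J)) (word_elt A (subword J) N) k" by simp
      \<comment> \<open>The zero weight is written as an empty sum, so that
        \<open>word_elt_sum\<close> evaluates the word on it.\<close>
      also have "\<dots> = word_elt A (rev (subword J)) (\<lambda>k. \<Sum>t\<in>{}. (a t :: int) * vtx_weight t k) k"
        by (rule word_elt_cong_supported[of _ J]) (use k a W in \<open>auto simp: N_def\<close>)
      also have "\<dots> = 0" unfolding word_elt_sum by simp
      finally show ?thesis .
    qed
    moreover have "N k = (\<Sum>s\<in>tau_inv J ` S. a (g s) * vtx_weight s k)" for k
      unfolding N_def sum.reindex[OF inj] by (rule sum.cong) (auto simp: g)
    ultimately have "\<forall>k\<in>J. (\<Sum>s\<in>tau_inv J ` S. a (g s) * vtx_weight s k) = 0" by simp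
    then have "\<forall>s\<in>tau_inv J ` S. a (g s) = 0"
      using zbasis_indep[OF b, of "\<lambda>s. a (g s)"] by blast
    then show ?thesis using g by force
  qed
  ultimately show ?thesis using fin unfolding zbasis_def by blast
qed

definition pairwise_zero :: "('i + ('i \<Rightarrow> int)) set \<Rightarrow> bool" where
  "pairwise_zero S \<longleftrightarrow> (\<forall>s\<in>S. \<forall>t\<in>S. s \<noteq> t \<longrightarrow> scaled_degree s t = 0)"

definition cluster :: "'i set \<Rightarrow> ('i + ('i \<Rightarrow> int)) set \<Rightarrow> bool" where
  "cluster J S \<longleftrightarrow> S \<subseteq> vtx J \<and> pairwise_zero S \<and>
     (\<forall>T. S \<subseteq> T \<and> T \<subseteq> vtx J \<and> pairwise_zero T \<longrightarrow> T = S)"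

lemma clusterD:
  assumes "cluster J S"
  shows "S \<subseteq> vtx J" "pairwise_zero S" "S \<subseteq> T \<Longrightarrow> T \<subseteq> vtx J \<Longrightarrow> pairwise_zero T \<Longrightarrow> T = S"
  using assms unfolding cluster_def by simp_all

lemma pairwise_zero_tau_inv:
  assumes "S \<subseteq> vtx J" shows "pairwise_zero (tau_inv J ` S) \<longleftrightarrow> pairwise_zero S"
proof -
  have "tau_inv J s = tau_inv J t \<longleftrightarrow> s = t" "scaled_degree (tau_inv J s) (tau_inv J t) = scaled_degree s t" if "s \<in> S" "t \<in> S" for s t
    using that assms inj_onD[OF tau_inv_inj] scaled_degree_tau_inv by blast+
  then show ?thesis unfolding pairwise_zero_def by (auto simp: ball_simps)
qed

lemma cluster_tau_inv: assumes "cluster J S" shows "cluster J (tau_inv J ` S)"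
proof -
  have S: "S \<subseteq> vtx J" "pairwise_zero S" using clusterD[OF assms] by simp_all
  have "T = tau_inv J ` S" if T: "tau_inv J ` S \<subseteq> T" "T \<subseteq> vtx J" "pairwise_zero T" for T
  proof -
    define T' where "T' = {t \<in> vtx J. tau_inv J t \<in> T}"
    have T': "T = tau_inv J ` T'" using T(2) tau_inv_bij[of J] by (auto simp: T'_def bij_betw_def)
    have sub: "T' \<subseteq> vtx J" by (auto simp: T'_def)
    then have "pairwise_zero T'" using T(3) T' pairwise_zero_tau_inv by simp
    moreover have "S \<subseteq> T'" using S(1) T(1) by (auto simp: T'_def)
    ultimately have "T' = S" using clusterD(3)[OF assms _ sub] by simp
    with T' show ?thesis by simp
  qed
  moreover have "tau_inv J ` S \<subseteq> vtx J" using S(1) by auto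
  moreover have "pairwise_zero (tau_inv J ` S)" using S pairwise_zero_tau_inv by simp
  ultimately show ?thesis unfolding cluster_def by (intro conjI allI impI) auto
qed

lemma supported_remove: "supported (J - {i}) x \<longleftrightarrow> supported J x \<and> x i = 0"
  by (auto simp: supported_def)

text \<open>Degree 0 with omega_i means that the \<open>i\<close>-th coordinate of a root vanishes,
  so \<open>vtx (J - {i})\<close> is exactly the set of vertices of J compatible with, and different
  from, \<open>Inl i\<close>. Maximality transfers since the degree does not mention J.\<close>

lemma cluster_remove:
  assumes c: "cluster J S" and i: "Inl i \<in> S"
  shows "cluster (J - {i}) (S - {Inl i})"
proof -
  have S: "S \<subseteq> vtx J" "pairwise_zero S" using clusterD[OF c] by simp_all
  have "i \<in> J" using S i by auto
  have sub: "S - {Inl i} \<subseteq> vtx (J - {i})"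
  proof
    fix t assume t: "t \<in> S - {Inl i}"
    then have "scaled_degree (Inl i) t = 0" "t \<in> vtx J" using S i unfolding pairwise_zero_def by auto
    then show "t \<in> vtx (J - {i})" using t dpos[of i] by (cases t) (auto simp: supported_remove)
  qed
  moreover have "pairwise_zero (S - {Inl i})" using S(2) by (auto simp: pairwise_zero_def)
  moreover have "T = S - {Inl i}" if T: "S - {Inl i} \<subseteq> T" "T \<subseteq> vtx (J - {i})" "pairwise_zero T" for T
  proof -
    have z: "scaled_degree (Inl i) t = 0" "t \<in> vtx J" "t \<noteq> Inl i" if "t \<in> T" for t
      using T(2) that by (cases t; force simp: supported_remove)+
    then have "pairwise_zero (insert (Inl i) T)"
      using T(3) scaled_degree_sym by (auto simp: pairwise_zero_def)
    moreover have "insert (Inl i) T \<subseteq> vtx J" using z \<open>i \<in> J\<close> by auto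
    ultimately have "insert (Inl i) T = S" using clusterD(3)[OF c] T(1) by (metis Diff_subset_conv insert_is_Un)
    then show ?thesis using z(3) by blast
  qed
  ultimately show ?thesis unfolding cluster_def by (intro conjI allI impI) auto
qed

text \<open>In a periodic sequence of this kind the sum of \<open>x\<close> over a period is killed by \<open>A = M + N\<close>.\<close>

lemma no_positive_orbit:
  assumes pos: "\<And>n. posroot (x n)" and sup: "\<And>n. supported J (x n)"
    and step: "\<And>n k. k \<in> J \<Longrightarrow> mv M (x n) k = - mv N (x (Suc n)) k"
    and split: "\<And>y k. mv A y k = mv M y k + mv N y k"
  shows False
proof -
  have "range x \<subseteq> {x. root x}" using pos by (auto simp: posroot_def)
  then have "finite (range x)" using finite_roots by (rule finite_subset)
  then have "\<not> inj x" using finite_imageD infinite_UNIV_nat by blast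
  then obtain m n where mn: "m < n" "x m = x n" unfolding inj_def by (metis linorder_neqE_nat)
  define y where "y = (\<lambda>k. \<Sum>l\<in>{m..<n}. x l k)"
  have "mv A y k = 0" if k: "k \<in> J" for k
  proof -
    have "mv M y k = (\<Sum>l\<in>{m..<n}. - mv N (x (Suc l)) k)"
      unfolding y_def mv_sum by (rule sum.cong) (use step k in auto)
    moreover have "mv N y k = (\<Sum>l\<in>{m..<n}. mv N (x l) k)" unfolding y_def by (rule mv_sum)
    ultimately have "mv A y k = (\<Sum>l\<in>{m..<n}. mv N (x l) k - mv N (x (Suc l)) k)"
      by (simp add: split sum_subtractf sum_negf)
    also have "\<dots> = - (\<Sum>l\<in>{m..<n}. mv N (x (Suc l)) k - mv N (x l) k)"
      by (simp add: sum_negf[symmetric])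
    also have "\<dots> = - (mv N (x n) k - mv N (x m) k)"
      using mn by (subst sum_Suc_diff') auto
    finally show ?thesis using mn by simp
  qed
  moreover have "supported J y" using sup by (simp add: supported_def y_def)
  ultimately have "y = (\<lambda>k. 0)" using A_inj_supported[of J y] by simp
  moreover obtain k where "x m k > 0" using posroot_pos[OF pos] .
  moreover have "x m k \<le> y k" unfolding y_def
    by (rule member_le_sum) (use mn pos in \<open>auto simp: posroot_def\<close>)
  ultimately show False by simp
qed

lemma tau_inv_funpow_in: "t \<in> vtx J \<Longrightarrow> (tau_inv J ^^ n) t \<in> vtx J"
  by (induction n) auto

text \<open>An orbit avoiding fundamental weights would be a sequence of positive roots with
  \<open>upp\<close> x_n = -\<open>low\<close> x_(n+1), which \<open>no_positive_orbit\<close>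
  excludes.\<close>

lemma tau_inv_reaches_Inl:
  assumes t: "t \<in> vtx J" shows "\<exists>n i. (tau_inv J ^^ n) t = Inl i"
proof (rule ccontr)
  assume "\<not> ?thesis"
  then have "\<forall>n. \<exists>x. (tau_inv J ^^ n) t = Inr x" by (metis sum.exhaust)
  then obtain x where x: "\<And>n. (tau_inv J ^^ n) t = Inr (x n)" by metis
  have in_vtx: "Inr (x n) \<in> vtx J" for n using tau_inv_funpow_in[OF t, of n] x by simp
  show False
  proof (rule no_positive_orbit[of x J upp low])
    fix n k assume k: "k \<in> J"
    have "tau_inv J (Inr (x n)) = Inr (x (Suc n))" using x[of n] x[of "Suc n"] by simp
    then show "mv upp (x n) k = - mv low (x (Suc n)) k"
      using vtx_weight_tau_inv_Inr[OF in_vtx[of n] k] by simp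
  qed (use in_vtx in \<open>auto simp: mv_A\<close>)
qed

lemma cluster_zbasis: "cluster J S \<Longrightarrow> zbasis J S"
proof (induction "card J" arbitrary: J S rule: less_induct)
  case less
  have hit: "zbasis J S" if c: "cluster J S" and i: "Inl i \<in> S" for S i
  proof -
    have "i \<in> J" using clusterD(1)[OF c] i by auto
    then have "card (J - {i}) < card J" by (intro psubset_card_mono) auto
    then have "zbasis (J - {i}) (S - {Inl i})"
      using less.hyps cluster_remove[OF c i] by blast
    then have "zbasis J (insert (Inl i) (S - {Inl i}))"
      using \<open>i \<in> J\<close> by (intro zbasis_insert_Inl) auto
    then show ?thesis using i by (simp add: insert_absorb)
  qed
  \<comment> \<open>Rotation by \<open>tau_inv\<close> stops as soon as any member of
    \<open>S\<close> is a fundamental weight, since bases are transported linearly only as long as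
    there is none.\<close>
  have reach: "zbasis J S" if "cluster J S" "t \<in> S" "(tau_inv J ^^ n) t = Inl i" for S n t i
    using that
  proof (induction n arbitrary: S t)
    case 0 then show ?case using hit by simp
  next
    case (Suc n)
    show ?case
    proof (cases "\<exists>j. Inl j \<in> S")
      case True then show ?thesis using hit Suc.prems by blast
    next
      case False
      have "(tau_inv J ^^ n) (tau_inv J t) = Inl i" using Suc.prems by (simp add: funpow_swap1)
      then have "zbasis J (tau_inv J ` S)"
        by (rule Suc.IH[OF cluster_tau_inv[OF Suc.prems(1)] imageI[OF Suc.prems(2)]])
      then show ?thesis
        by (rule zbasis_tau_inv[OF _ clusterD(1)[OF Suc.prems(1)]]) (use False in blast)
    qed
  qed
  show ?case
  proof (cases "S = {}")
    case False
    then obtain t where "t \<in> S" by auto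
    moreover then obtain n i where "(tau_inv J ^^ n) t = Inl i"
      using tau_inv_reaches_Inl[of t J] clusterD(1)[OF less.prems] by blast
    ultimately show ?thesis using reach less.prems by blast
  next
    case True
    \<comment> \<open>A single fundamental weight already forms a compatible set, so the empty set
      is maximal only for empty J.\<close>
    have "J = {}"
    proof (rule ccontr)
      assume "J \<noteq> {}"
      then obtain i where "i \<in> J" by auto
      then have "{Inl i} \<subseteq> vtx J" "pairwise_zero {Inl i}" by (auto simp: pairwise_zero_def)
      then show False using clusterD(3)[OF less.prems, of "{Inl i}"] True by simp
    qed
    then show ?thesis using True by (simp add: zbasis_def)
  qed
qed

subsection \<open>The longest element\<close>

text \<open>The deletion property: if \<open>us\<close> makes alpha_i negative, some suffix
  \<open>b\<close> maps alpha_i to alpha_j, where \<open>j\<close> is the letter before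
  \<open>b\<close>. Then b s_i = s_j b, and s_j cancels.\<close>

lemma root_word_delete:
  assumes "\<not> posroot (root_word A us (fund_weight i))"
  shows "\<exists>vs. length vs < length us \<and> word_elt A vs = word_elt A (us @ [i])"
proof -
  have "\<not> posroot (root_word A (rev (rev us)) (fund_weight i))" using assms by simp
  from root_word_becomes_negative[OF posroot_fund_weight this]
  obtain b' j a' where s: "rev us = b' @ j # a'" "fund_weight i = root_word A b' (fund_weight j)"
    by blast
  define a where "a = rev a'"
  define b where "b = rev b'"
  have us: "us = a @ j # b" using arg_cong[OF s(1), of rev] by (simp add: a_def b_def)
  have bi: "root_word A b (fund_weight i) = fund_weight j" using s(2) by (simp add: b_def)
  have dij: "d i = d j" using euler_word[of b "fund_weight i"] by (simp add: bi euler_fund_weight)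
  \<comment> \<open>The identity b s_i = s_j b: the coefficient \<open>l i\<close> is matched
    through the invariant pairing, the root through \<open>mv A\<close>.\<close>
  have comm: "word_elt A b (simple_refl A i l) = simple_refl A j (word_elt A b l)" for l
  proof -
    have "d j * word_elt A b l j = d i * l i"
      using pairing_word[of b l "fund_weight i"] by (simp add: bi pairing_fund_weight)
    then have lj: "word_elt A b l j = l i" using dij dpos[of j] by simp
    have "word_elt A b (mv A (fund_weight i)) = mv A (fund_weight j)"
      by (simp add: mv_root_word[symmetric] bi)
    then have al: "word_elt A b (\<lambda>k. A k i) = (\<lambda>k. A k j)" by (simp add: mv_fund_weight[abs_def])
    show ?thesis by (rule ext) (simp add: simple_refl_def word_elt_lin al lj)
  qed
  have "word_elt A (us @ [i]) = word_elt A (a @ b)"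
    by (rule ext) (simp add: us comm)
  then show ?thesis by (intro exI[of _ "a @ b"]) (simp add: us)
qed

lemma weyl_length_word:
  obtains vs where "word_elt A vs = word_elt A us" "length vs = weyl_length A (word_elt A us)"
  using LeastI_ex[of "\<lambda>n. \<exists>vs. length vs = n \<and> word_elt A vs = word_elt A us"]
  unfolding weyl_length_def by blast

lemma weyl_length_le: "weyl_length A (word_elt A us) \<le> length us"
  unfolding weyl_length_def by (rule Least_le) blast

lemma root_word_snoc: "root_word A (us @ [i]) (fund_weight i) = (\<lambda>k. - root_word A us (fund_weight i) k)"
  by (simp add: root_refl_fund_weight root_word_minus)

lemma reduced_snoc:
  assumes "length (us @ [i]) = weyl_length A (word_elt A (us @ [i]))"
  shows "posroot (root_word A us (fund_weight i))"
proof (rule ccontr)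
  assume "\<not> ?thesis"
  then obtain vs where vs: "length vs < length us" "word_elt A vs = word_elt A (us @ [i])"
    using root_word_delete by blast
  have "weyl_length A (word_elt A (us @ [i])) \<le> length vs" using weyl_length_le[of vs] vs(2) by simp
  with vs(1) assms show False by simp
qed

text \<open>An element is determined by its values on the simple roots, and these lie in the finite
  set of roots.\<close>

lemma finite_weyl_group: "finite (weyl_group A)"
proof -
  define f where "f = (\<lambda>vs i. root_word A vs (fund_weight i))"
  have "root (f vs i)" for vs i
    unfolding f_def using posroot_fund_weight root_word_root unfolding posroot_def by blast
  then have "range f \<subseteq> (\<Pi>\<^sub>E i\<in>UNIV. {x. root x})" by auto
  then have fin: "finite (range f)"
    by (rule finite_subset) (simp add: finite_PiE finite_roots)
  have det: "word_elt A us = word_elt A vs" if "f us = f vs" for us vs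
  proof (rule ext, rule ext)
    fix l k
    have eq: "root_word A us x = root_word A vs x" for x
    proof
      fix k
      show "root_word A us x k = root_word A vs x k"
        using fun_cong[OF that] unfolding f_def
        by (subst (1 2) root_word_expand) simp
    qed
    define x where "x = root_word A (rev us) (fund_weight k)"
    have "pairing (word_elt A us l) (fund_weight k) = pairing l x"
      using pairing_word[of us l x] by (simp add: x_def)
    also have "\<dots> = pairing (word_elt A vs l) (fund_weight k)"
      using pairing_word[of vs l x] by (simp add: eq[symmetric], simp add: x_def)
    finally show "word_elt A us l k = word_elt A vs l k"
      using dpos[of k] by (simp add: pairing_fund_weight)
  qed
  have "word_elt A vs = word_elt A (inv f (f vs))" for vs
    using det[of vs "inv f (f vs)"] by (simp add: f_inv_into_f)
  then have "weyl_group A \<subseteq> (\<lambda>g. word_elt A (inv f g)) ` range f"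
    unfolding weyl_group_def by blast
  then show ?thesis using fin by (rule finite_surj[rotated])
qed

definition is_longest :: "(('i \<Rightarrow> int) \<Rightarrow> 'i \<Rightarrow> int) \<Rightarrow> bool" where
  "is_longest w \<longleftrightarrow> w \<in> weyl_group A \<and> (\<forall>v\<in>weyl_group A. weyl_length A v \<le> weyl_length A w)"

lemma is_longest_ex: "\<exists>w. is_longest w"
proof -
  have "weyl_group A \<noteq> {}" by (simp add: weyl_group_def)
  then have "Max (weyl_length A ` weyl_group A) \<in> weyl_length A ` weyl_group A"
    using finite_weyl_group by (intro Max_in) auto
  then obtain w where "w \<in> weyl_group A" "weyl_length A w = Max (weyl_length A ` weyl_group A)"
    by auto
  then show ?thesis
    unfolding is_longest_def using finite_weyl_group by (intro exI[of _ w]) auto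
qed

text \<open>If w keeps alpha_i positive, w s_i makes it negative, so a reduced word of w s_i
  followed by s_i can be shortened. Then w is shorter than w s_i, against maximality.\<close>

lemma is_longest_neg:
  assumes "is_longest (word_elt A vs)"
  shows "\<not> posroot (root_word A vs (fund_weight i))"
proof
  assume p: "posroot (root_word A vs (fund_weight i))"
  obtain us where us: "word_elt A us = word_elt A (vs @ [i])"
      "length us = weyl_length A (word_elt A (vs @ [i]))"
    by (rule weyl_length_word)
  have "root_word A us (fund_weight i) = (\<lambda>k. - root_word A vs (fund_weight i) k)"
    using root_word_cong[OF us(1)] root_word_snoc by simp
  then have "\<not> posroot (root_word A us (fund_weight i))" using not_posroot_both[OF p] by simp
  then obtain us' where us': "length us' < length us" "word_elt A us' = word_elt A (us @ [i])"
    using root_word_delete by blast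
  have "word_elt A us' = word_elt A vs"
    by (rule ext) (simp add: us'(2) us(1))
  then have "weyl_length A (word_elt A vs) \<le> length us'" using weyl_length_le[of us'] by simp
  moreover have "length us \<le> weyl_length A (word_elt A vs)"
    using assms us(2) unfolding is_longest_def weyl_group_def by auto
  ultimately show False using us'(1) by simp
qed

text \<open>A nonempty reduced word sends the simple root of its last letter to a negative
  root.\<close>

lemma word_elt_id:
  assumes "\<And>i. posroot (root_word A vs (fund_weight i))"
  shows "word_elt A vs = id"
proof -
  obtain us where us: "word_elt A us = word_elt A vs" "length us = weyl_length A (word_elt A vs)"
    by (rule weyl_length_word)
  show ?thesis
  proof (cases us rule: rev_cases)
    case Nil then show ?thesis using us(1) by simp
  next
    case (snoc us' i)
    then have p: "posroot (root_word A us' (fund_weight i))" using us by (intro reduced_snoc) simp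
    have "root_word A vs (fund_weight i) = (\<lambda>k. - root_word A us' (fund_weight i) k)"
      using root_word_cong[OF us(1)] root_word_snoc[of us' i] snoc by simp
    then show ?thesis using assms[of i] not_posroot_both[OF p] by simp
  qed
qed

lemma posroot_neg: "root x \<Longrightarrow> \<not> posroot x \<Longrightarrow> posroot (\<lambda>k. - x k)"
  using root_sign by blast

lemma root_word_fund_root: "root (root_word A vs (fund_weight i))"
  using posroot_fund_weight root_word_root unfolding posroot_def by blast

lemma root_word_neg:
  assumes n: "\<And>i. \<not> posroot (root_word A vs (fund_weight i))" and y: "posroot y"
  shows "\<not> posroot (root_word A vs y)"
proof -
  have le: "root_word A vs (fund_weight j) k \<le> 0" for j k
    using posroot_neg[OF root_word_fund_root n, of j] unfolding posroot_def by (metis neg_0_le_iff_le)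
  have "root_word A vs y k \<le> 0" for k
    unfolding root_word_expand[of A vs y]
    by (rule sum_nonpos) (use y le in \<open>auto simp: posroot_def mult_nonneg_nonpos\<close>)
  then show ?thesis using posroot_pos by (metis not_le)
qed

text \<open>Both elements make all positive roots negative, so v^-1 w keeps the simple roots
  positive and is the identity.\<close>

lemma is_longest_unique:
  assumes "is_longest v" "is_longest w" shows "v = w"
proof -
  obtain us vs where eq: "v = word_elt A us" "w = word_elt A vs"
    using assms unfolding is_longest_def weyl_group_def by blast
  have us: "\<And>i. \<not> posroot (root_word A us (fund_weight i))"
    and vs: "\<And>i. \<not> posroot (root_word A vs (fund_weight i))"
    using assms is_longest_neg unfolding eq by blast+
  have "posroot (root_word A (rev us @ vs) (fund_weight i))" for i
  proof (rule ccontr)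
    assume a: "\<not> ?thesis"
    define y where "y = (\<lambda>k. - root_word A (rev us @ vs) (fund_weight i) k)"
    have "posroot y" unfolding y_def by (rule posroot_neg[OF root_word_fund_root a])
    then have "\<not> posroot (root_word A us y)" using us root_word_neg by blast
    moreover have "root_word A us y = (\<lambda>k. - root_word A vs (fund_weight i) k)"
      by (simp add: y_def root_word_minus)
    ultimately show False using posroot_neg[OF root_word_fund_root vs] by simp
  qed
  then have id: "word_elt A (rev us @ vs) = id" by (rule word_elt_id)
  have "word_elt A us l = word_elt A vs l" for l
  proof -
    have "word_elt A us l = word_elt A us (word_elt A (rev us @ vs) l)" by (simp only: id id_apply)
    then show ?thesis by simp
  qed
  then show ?thesis using eq by auto
qed

text \<open>\<open>d k\<close> times coordinate \<open>k\<close> of w_0 omega_i is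
  \<open>d i\<close> times coordinate \<open>i\<close> of the root w_0^-1 alpha_k. This root is
  negative, since w_0 maps it to the positive root alpha_k.\<close>

lemma longest_elt_antidominant:
  obtains vs where "longest_elt A = word_elt A vs" "\<And>i k. word_elt A vs (fund_weight i) k \<le> 0"
proof -
  obtain w where w: "is_longest w" using is_longest_ex by blast
  have "longest_elt A = w"
    unfolding longest_elt_def is_longest_def[symmetric]
    by (rule the_equality) (use w is_longest_unique in blast)+
  moreover obtain vs where vs: "w = word_elt A vs"
    using w unfolding is_longest_def weyl_group_def by blast
  moreover have "word_elt A vs (fund_weight i) k \<le> 0" for i k
  proof -
    define x where "x = root_word A (rev vs) (fund_weight k)"
    have "\<not> posroot x"
    proof
      assume "posroot x"
      then have "\<not> posroot (root_word A vs x)"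
        using root_word_neg is_longest_neg w vs by blast
      then show False by (simp add: x_def)
    qed
    then have "x i \<le> 0"
      using posroot_neg[of x] root_word_fund_root unfolding x_def posroot_def by (metis neg_0_le_iff_le)
    moreover have "d k * word_elt A vs (fund_weight i) k = d i * x i"
      using pairing_word[of vs "fund_weight i" x]
      by (simp add: x_def pairing_fund_weight pairing_fund_weight_left)
    ultimately have "d k * word_elt A vs (fund_weight i) k \<le> 0"
      using dpos[of i] by (simp add: mult_nonneg_nonpos)
    then show ?thesis using dpos[of k] by (simp add: mult_le_0_iff)
  qed
  ultimately show ?thesis using that by blast
qed

text \<open>For a reduced word ending in \<open>i\<close>, the last letter adds
  (-\<open>l i\<close>) times the positive root us alpha_i; a word that is not reduced is first
  replaced by a shorter one.\<close>

lemma antidominant_orbit: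
  assumes l: "\<And>k. l k \<le> 0"
  shows "\<exists>y. (\<forall>k. 0 \<le> y k) \<and> word_elt A vs l = (\<lambda>k. l k + mv A y k)"
proof (induction "length vs" arbitrary: vs rule: less_induct)
  case less
  show ?case
  proof (cases "length vs = weyl_length A (word_elt A vs)")
    case False
    obtain us where us: "word_elt A us = word_elt A vs" "length us = weyl_length A (word_elt A vs)"
      by (rule weyl_length_word)
    then have "length us < length vs" using False weyl_length_le[of vs] by simp
    then show ?thesis using less[of us] us(1) by simp
  next
    case True
    show ?thesis
    proof (cases vs rule: rev_cases)
      case Nil
      then show ?thesis by (intro exI[of _ "\<lambda>k. 0"]) (simp add: mv_def)
    next
      case (snoc us i)
      have p: "posroot (root_word A us (fund_weight i))" by (rule reduced_snoc) (use True snoc in simp)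
      obtain y where y: "\<forall>k. 0 \<le> y k" "word_elt A us l = (\<lambda>k. l k + mv A y k)"
        using less[of us] snoc by auto
      define z where "z = (\<lambda>k. y k + (- l i) * root_word A us (fund_weight i) k)"
      have "0 \<le> (- l i) * root_word A us (fund_weight i) k" for k
        using l[of i] p unfolding posroot_def by (intro mult_nonneg_nonneg) auto
      then have "\<forall>k. 0 \<le> z k" using y(1) unfolding z_def by (meson add_nonneg_nonneg)
      moreover have "word_elt A vs l = (\<lambda>k. l k + mv A z k)"
      proof -
        have "word_elt A us (mv A (fund_weight i)) = mv A (root_word A us (fund_weight i))"
          by (simp add: mv_root_word)
        then have "word_elt A us (\<lambda>k. A k i) = mv A (root_word A us (fund_weight i))"
          by (simp add: mv_fund_weight[abs_def])
        moreover have "word_elt A vs l = word_elt A us (\<lambda>k. l k - l i * A k i)"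
          by (simp add: snoc simple_refl_def)
        moreover have "mv A z k = mv A y k + (- l i) * mv A (root_word A us (fund_weight i)) k" for k
          unfolding z_def mv_add mv_scale ..
        ultimately show ?thesis by (simp add: word_elt_lin y(2) add_diff_eq)
      qed
      ultimately show ?thesis by blast
    qed
  qed
qed

text \<open>Each of the two weights exceeds the other by a nonnegative combination of simple roots,
  so both combinations vanish.\<close>

lemma antidominant_unique:
  assumes "\<And>k. l k \<le> 0" "\<And>k. word_elt A vs l k \<le> 0"
  shows "word_elt A vs l = l"
proof -
  obtain y where y: "\<forall>k. 0 \<le> y k" "word_elt A vs l = (\<lambda>k. l k + mv A y k)"
    using antidominant_orbit[of l vs] assms(1) by auto
  obtain z where z: "\<forall>k. 0 \<le> z k"
      "word_elt A (rev vs) (word_elt A vs l) = (\<lambda>k. word_elt A vs l k + mv A z k)"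
    using antidominant_orbit[of "word_elt A vs l" "rev vs"] assms(2) by auto
  have l2: "l = (\<lambda>k. l k + mv A y k + mv A z k)" using z(2) word_rev[of vs l] y(2) by simp
  have "mv A (\<lambda>k. y k + z k) = mv A (\<lambda>k. 0)"
  proof
    fix k
    show "mv A (\<lambda>k. y k + z k) k = mv A (\<lambda>k. 0) k"
      using fun_cong[OF l2, of k] by (simp add: mv_add) (simp add: mv_def)
  qed
  then have "(\<lambda>k. y k + z k) = (\<lambda>k. 0)" by (rule mv_A_inj)
  then have yz: "y k + z k = 0" for k by (rule fun_cong)
  have "y k = 0" for k using yz[of k] y(1)[rule_format, of k] z(1)[rule_format, of k] by linarith
  then have "y = (\<lambda>k. 0)" by (rule ext)
  then show ?thesis using y(2) by (simp add: mv_def)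
qed

text \<open>w_0 omega_i and -omega_j are antidominant weights in one orbit, hence equal. So any Weyl
  group element with this effect on omega_i identifies i*.\<close>

lemma star_idx_eq:
  assumes "word_elt A vs (fund_weight i) = (\<lambda>k. - fund_weight j k)"
  shows "star_idx A i = j"
proof -
  obtain us where us: "longest_elt A = word_elt A us" "\<And>i k. word_elt A us (fund_weight i) k \<le> 0"
    using longest_elt_antidominant by blast
  have fi: "fund_weight i = word_elt A (rev vs) (\<lambda>k. - fund_weight j k)"
    using arg_cong[OF assms, of "word_elt A (rev vs)"] by simp
  have "word_elt A (us @ rev vs) (\<lambda>k. - fund_weight j k) = (\<lambda>k. - fund_weight j k)"
    by (rule antidominant_unique) (use us(2)[of i] fi in auto)
  then have "longest_elt A (fund_weight i) = (\<lambda>k. - fund_weight j k)"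
    using us(1) fi by simp
  then show ?thesis unfolding star_idx_def by auto
qed

subsection \<open>Weights in the orbits of the Coxeter element\<close>

definition cox :: "('i \<Rightarrow> int) \<Rightarrow> ('i \<Rightarrow> int)" where "cox = word_elt A ws"

lemma subword_UNIV [simp]: "subword UNIV = ws"
  by (simp add: subword_def)

lemma supported_UNIV [simp]: "supported UNIV x"
  by (simp add: supported_def)

lemma cox_low: "cox (\<lambda>k. mv upp z k) = (\<lambda>k. - mv low z k)"
  using word_elt_low[of UNIV z "\<lambda>k. mv upp z k"] by (auto simp: cox_def)

lemma inv_cox: "inv cox (\<lambda>k. - mv low z k) = (\<lambda>k. mv upp z k)"
proof -
  have "inj cox" by (rule inj_on_inverseI[of _ "word_elt A (rev ws)"]) (simp add: cox_def)
  then show ?thesis using cox_low[of z] by (metis inv_f_f)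
qed

lemma cox_fund_weight: "cox (fund_weight i) = vtx_weight (Inr (upp_root UNIV i))"
proof -
  have "fund_weight i = (\<lambda>k. mv upp (upp_root UNIV i) k)" by (rule ext) (simp add: upp_upp_root)
  then show ?thesis using cox_low[of "upp_root UNIV i"] by simp
qed

lemma cox_vtx_weight: "cox (vtx_weight (Inr x)) = vtx_weight (Inr (cox_root UNIV x))"
proof -
  have "vtx_weight (Inr x) = (\<lambda>k. mv upp (cox_root UNIV x) k)" by (rule ext) (simp add: upp_cox_root)
  then show ?thesis using cox_low[of "cox_root UNIV x"] by simp
qed

lemma vtx_weight_low_root: "vtx_weight (Inr (low_root UNIV i)) = (\<lambda>k. - fund_weight i k)"
  by (rule ext) (simp add: low_low_root)

lemma vtx_weight_Inr_inj: "vtx_weight (Inr x) = vtx_weight (Inr y) \<Longrightarrow> x = y"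
  by (rule low_inj[of UNIV]) (auto simp: fun_eq_iff)

text \<open>omega_i has the form -\<open>low\<close> x only for the negative root x =
  -\<open>low_root UNIV i\<close>.\<close>

lemma vtx_weight_Inr_ne: assumes "posroot x" shows "vtx_weight (Inr x) \<noteq> fund_weight i"
proof
  assume a: "vtx_weight (Inr x) = fund_weight i"
  have "vtx_weight (Inr (\<lambda>k. - low_root UNIV i k)) = fund_weight i"
    by (rule ext) (simp add: mv_minus low_low_root)
  then have "x = (\<lambda>k. - low_root UNIV i k)" using a vtx_weight_Inr_inj by metis
  then show False using assms not_posroot_both[of "low_root UNIV i"] by simp
qed

lemma vtx_weight_inj: "inj_on vtx_weight (vtx UNIV)"
proof (rule inj_onI)
  fix s t assume "s \<in> vtx UNIV" "t \<in> vtx UNIV" "vtx_weight s = vtx_weight t"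
  then show "s = t"
    using vtx_weight_Inr_inj vtx_weight_Inr_ne by (cases s; cases t) (simp_all del: vtx_weight.simps(2), metis)
qed

text \<open>\<open>N\<close> is the first index whose root is not positive. By
  \<open>cox_root_positive\<close> the root just before is some \<open>low_root\<close>; no earlier
  one is, since c would make it negative at once. Index \<open>n\<close> belongs to the weight
  c^(n+1) omega_i, so c^N omega_i = -omega_j.\<close>

lemma orbit_exit:
  obtains N j where "0 < N"
    "\<And>n. n < N \<Longrightarrow> posroot ((cox_root UNIV ^^ n) (upp_root UNIV i))"
    "\<And>n. n < N \<Longrightarrow> Suc n < N \<or> (cox_root UNIV ^^ n) (upp_root UNIV i) = low_root UNIV j"
    "\<And>n k. Suc n < N \<Longrightarrow> (cox_root UNIV ^^ n) (upp_root UNIV i) \<noteq> low_root UNIV k"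
proof -
  define x where "x = (\<lambda>n. (cox_root UNIV ^^ n) (upp_root UNIV i))"
  have Suc: "x (Suc n) = cox_root UNIV (x n)" for n by (simp add: x_def)
  have "\<exists>n. \<not> posroot (x n)"
  proof (rule ccontr)
    assume a: "\<not> ?thesis"
    show False
      by (rule no_positive_orbit[of x UNIV low upp]) (use a in \<open>auto simp: Suc upp_cox_root mv_A\<close>)
  qed
  define N where "N = (LEAST n. \<not> posroot (x n))"
  have N: "\<not> posroot (x N)" unfolding N_def by (rule LeastI_ex) fact
  have less: "posroot (x n)" if "n < N" for n using not_less_Least that unfolding N_def by blast
  have "0 < N" using N by (cases N) (auto simp: x_def)
  then obtain m where m: "N = Suc m" by (cases N) auto
  obtain j where j: "x m = low_root UNIV j"
    using cox_root_positive[of "x m" UNIV] N less[of m] m Suc by auto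
  have ne: "x n \<noteq> low_root UNIV k" if "Suc n < N" for n k
  proof
    assume "x n = low_root UNIV k"
    then have "x (Suc n) = (\<lambda>l. - upp_root UNIV k l)" by (simp add: Suc cox_root_low_root)
    then show False using less[OF that] not_posroot_both[of "upp_root UNIV k"] by simp
  qed
  show ?thesis
    by (rule that[of N j]) (use \<open>0 < N\<close> less ne j m in \<open>auto simp: x_def less_Suc_eq\<close>)
qed

lemma cox_funpow: "(cox ^^ Suc n) (fund_weight i) = vtx_weight (Inr ((cox_root UNIV ^^ n) (upp_root UNIV i)))"
  by (induction n) (simp_all del: vtx_weight.simps add: cox_fund_weight cox_vtx_weight)

lemma cox_funpow_word: "\<exists>vs. cox ^^ n = word_elt A vs"
proof (induction n)
  case 0 then show ?case by (intro exI[of _ "[]"]) simp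
next
  case (Suc n)
  then obtain vs where "cox ^^ n = word_elt A vs" by blast
  then have "cox ^^ Suc n = word_elt A (ws @ vs)" by (auto simp: cox_def)
  then show ?case by blast
qed

text \<open>\<open>h_idx\<close> is the exit index: \<open>star_idx_eq\<close> turns the
  \<open>j\<close> found there into i*, and -omega_j comes from \<open>low_root UNIV j\<close>
  alone, which does not occur earlier.\<close>

lemma h_idx_exit:
  obtains j where "0 < h_idx A cox i"
    "\<And>n. n < h_idx A cox i \<Longrightarrow> posroot ((cox_root UNIV ^^ n) (upp_root UNIV i))"
    "\<And>n. n < h_idx A cox i \<Longrightarrow> Suc n < h_idx A cox i \<or> (cox_root UNIV ^^ n) (upp_root UNIV i) = low_root UNIV j"
proof -
  obtain N j where N: "0 < N"
    "\<And>n. n < N \<Longrightarrow> posroot ((cox_root UNIV ^^ n) (upp_root UNIV i))"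
    "\<And>n. n < N \<Longrightarrow> Suc n < N \<or> (cox_root UNIV ^^ n) (upp_root UNIV i) = low_root UNIV j"
    "\<And>n k. Suc n < N \<Longrightarrow> (cox_root UNIV ^^ n) (upp_root UNIV i) \<noteq> low_root UNIV k"
    using orbit_exit[of i] by auto
  obtain m where m: "N = Suc m" using N(1) by (cases N) auto
  have xm: "(cox_root UNIV ^^ m) (upp_root UNIV i) = low_root UNIV j" using N(3)[of m] m by simp
  have cN: "(cox ^^ N) (fund_weight i) = (\<lambda>k. - fund_weight j k)"
    unfolding m cox_funpow xm by (rule vtx_weight_low_root)
  obtain vs where "cox ^^ N = word_elt A vs" using cox_funpow_word by blast
  then have star: "star_idx A i = j" using cN star_idx_eq by metis
  have "h_idx A cox i = N"
    unfolding h_idx_def star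
  proof (rule Least_equality)
    show "0 < N \<and> (cox ^^ N) (fund_weight i) = (\<lambda>k. - fund_weight j k)" using N(1) cN by simp
    fix n assume n: "0 < n \<and> (cox ^^ n) (fund_weight i) = (\<lambda>k. - fund_weight j k)"
    then obtain l where l: "n = Suc l" by (cases n) auto
    have "vtx_weight (Inr ((cox_root UNIV ^^ l) (upp_root UNIV i))) = vtx_weight (Inr (low_root UNIV j))"
      using n unfolding l cox_funpow vtx_weight_low_root by blast
    then have "(cox_root UNIV ^^ l) (upp_root UNIV i) = low_root UNIV j" by (rule vtx_weight_Inr_inj)
    then have "\<not> Suc l < N" using N(4) by blast
    then show "N \<le> n" using l by simp
  qed
  then show ?thesis using that[of j] N by blast
qed

text \<open>For the reverse inclusion a vertex is followed along \<open>tau_inv\<close> to a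
  fundamental weight, and the steps are then undone by c.\<close>

lemma Pi_c_vtx_weight: "Pi_c A cox = vtx_weight ` vtx UNIV"
proof
  show "Pi_c A cox \<subseteq> vtx_weight ` vtx UNIV"
  proof
    fix l assume "l \<in> Pi_c A cox"
    then obtain i m where l: "l = (cox ^^ m) (fund_weight i)" "m \<le> h_idx A cox i"
      unfolding Pi_c_def by blast
    show "l \<in> vtx_weight ` vtx UNIV"
    proof (cases m)
      case 0
      then have "l = vtx_weight (Inl i)" using l by simp
      then show ?thesis by (simp del: vtx_weight.simps)
    next
      case (Suc n)
      then have "l = vtx_weight (Inr ((cox_root UNIV ^^ n) (upp_root UNIV i)))" using l cox_funpow by metis
      moreover have "posroot ((cox_root UNIV ^^ n) (upp_root UNIV i))"
        using h_idx_exit[of i] l(2) Suc by (metis Suc_le_eq)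
      ultimately show ?thesis by (simp del: vtx_weight.simps)
    qed
  qed
  have reach: "vtx_weight t \<in> Pi_c A cox" if "t \<in> vtx UNIV" "(tau_inv UNIV ^^ n) t = Inl i" for t n i
    using that
  proof (induction n arbitrary: t)
    case 0
    then have "vtx_weight t = (cox ^^ 0) (fund_weight i)" by simp
    then show ?case unfolding Pi_c_def by blast
  next
    case (Suc n)
    have IH: "vtx_weight (tau_inv UNIV t) \<in> Pi_c A cox"
      using Suc.IH[of "tau_inv UNIV t"] Suc.prems by (simp add: funpow_swap1)
    show ?case
    proof (cases t)
      case (Inl j)
      then have "vtx_weight t = (cox ^^ 0) (fund_weight j)" by simp
      then show ?thesis unfolding Pi_c_def by blast
    next
      case (Inr x)
      have w: "vtx_weight t = cox (vtx_weight (tau_inv UNIV t))"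
        using vtx_weight_tau_inv[of x UNIV] Suc.prems(1) Inr by (auto simp: cox_def simp del: vtx_weight.simps)
      obtain i m where m: "vtx_weight (tau_inv UNIV t) = (cox ^^ m) (fund_weight i)" "m \<le> h_idx A cox i"
        using IH unfolding Pi_c_def by blast
      \<comment> \<open>At the exponent \<open>h_idx\<close> the weight is -omega_j, the image of
        \<open>Inl j\<close>; injectivity would turn \<open>t\<close> into a fundamental
        weight.\<close>
      have "m \<noteq> h_idx A cox i"
      proof
        assume eq: "m = h_idx A cox i"
        obtain j where j: "0 < h_idx A cox i"
          "\<And>n. n < h_idx A cox i \<Longrightarrow> Suc n < h_idx A cox i \<or> (cox_root UNIV ^^ n) (upp_root UNIV i) = low_root UNIV j"
          using h_idx_exit[of i] by metis
        obtain n where n: "m = Suc n" using j(1) unfolding eq[symmetric] by (cases m) auto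
        have "vtx_weight (tau_inv UNIV t) = vtx_weight (Inr (low_root UNIV j))"
          using m(1) j(2)[of n] eq n cox_funpow by (metis lessI less_irrefl)
        then have "vtx_weight (tau_inv UNIV t) = vtx_weight (tau_inv UNIV (Inl j))" by simp
        then have "tau_inv UNIV t = tau_inv UNIV (Inl j)"
          using inj_onD[OF vtx_weight_inj] Suc.prems(1) by (metis tau_inv_in vtx_simps(1) UNIV_I)
        then have "t = Inl j" using inj_onD[OF tau_inv_inj] Suc.prems(1) by (metis vtx_simps(1) UNIV_I)
        then show False using Inr by simp
      qed
      then have "Suc m \<le> h_idx A cox i" using m(2) by simp
      moreover have "vtx_weight t = (cox ^^ Suc m) (fund_weight i)" using w m(1) by simp
      ultimately show ?thesis unfolding Pi_c_def by blast
    qed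
  qed
  show "vtx_weight ` vtx UNIV \<subseteq> Pi_c A cox" using tau_inv_reaches_Inl reach by blast
qed

section \<open>The compatibility degree in terms of vertices\<close>

lemma tau_c_vtx_weight_tau_inv:
  assumes t: "t \<in> vtx UNIV" shows "tau_c cox (vtx_weight (tau_inv UNIV t)) = vtx_weight t"
proof (cases t)
  case (Inl i)
  then have w: "vtx_weight (tau_inv UNIV t) = (\<lambda>k. - fund_weight i k)" using vtx_weight_low_root by simp
  have "(THE j. (\<lambda>k. - fund_weight i k) = (\<lambda>k. - fund_weight j k)) = i"
  proof (rule the_equality)
    fix j assume "(\<lambda>k. - fund_weight i k) = (\<lambda>k. - fund_weight j k :: int)"
    then have "fund_weight i = fund_weight j" by (auto simp: fun_eq_iff)
    then show "j = i" by simp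
  qed simp
  then show ?thesis unfolding tau_c_def w using Inl by auto
next
  case (Inr x)
  have "vtx_weight (tau_inv UNIV t) \<noteq> (\<lambda>k. - fund_weight j k)" for j
  proof
    assume "vtx_weight (tau_inv UNIV t) = (\<lambda>k. - fund_weight j k)"
    then have "vtx_weight (tau_inv UNIV t) = vtx_weight (tau_inv UNIV (Inl j))" using vtx_weight_low_root by simp
    then have "tau_inv UNIV t = tau_inv UNIV (Inl j)"
      using inj_onD[OF vtx_weight_inj] t by (metis tau_inv_in vtx_simps(1) UNIV_I)
    then have "t = Inl j" using inj_onD[OF tau_inv_inj] t by (metis vtx_simps(1) UNIV_I)
    then show False using Inr by simp
  qed
  then have "tau_c cox (vtx_weight (tau_inv UNIV t)) = cox (vtx_weight (tau_inv UNIV t))" unfolding tau_c_def by simp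
  also have "\<dots> = vtx_weight t"
    using vtx_weight_tau_inv[of x UNIV] t Inr by (auto simp: cox_def simp del: vtx_weight.simps)
  finally show ?thesis .
qed

lemma root_coeff_A: "root_coeff A (mv A x) i = x i"
proof -
  have eq: "(\<lambda>k. \<Sum>j\<in>UNIV. y j * simple_root A j k) = mv A y" for y
    by (rule ext) (simp add: simple_root_def mv_def mult.commute)
  have "(THE y. mv A x = mv A y) = x" by (rule the_equality) (auto dest: mv_A_inj)
  then show ?thesis unfolding root_coeff_def eq by simp
qed

text \<open>c^-1 maps -\<open>low\<close> z to \<open>upp\<close> z, so c^-1 - 1 yields
  \<open>upp\<close> z + \<open>low\<close> z = A z, the weight with simple root coordinates
  z.\<close>

lemma root_coeff_low:
  "root_coeff A (\<lambda>k. inv cox (\<lambda>k. - mv low z k) k - (- mv low z k)) i = z i"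
proof -
  have "(\<lambda>k. inv cox (\<lambda>k. - mv low z k) k - (- mv low z k)) = mv A z"
    by (rule ext) (simp add: inv_cox mv_A)
  then show ?thesis by (simp add: root_coeff_A)
qed

lemma root_coeff_vtx_weight:
  assumes t: "t \<in> vtx UNIV"
  shows "real_of_int (max 0 (root_coeff A (\<lambda>k. inv cox (vtx_weight t) k - vtx_weight t k) i)) = scaled_degree (Inl i) t / d i"
proof (cases t)
  case (Inl j)
  \<comment> \<open>omega_j corresponds to the negative root -\<open>low_root UNIV j\<close>, whose
    coefficients have positive part 0.\<close>
  have "vtx_weight t = (\<lambda>k. - mv low (\<lambda>k. - low_root UNIV j k) k)"
    using Inl by (auto simp: mv_minus low_low_root)
  then have "root_coeff A (\<lambda>k. inv cox (vtx_weight t) k - vtx_weight t k) i = - low_root UNIV j i"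
    using root_coeff_low[of "\<lambda>k. - low_root UNIV j k" i] by simp
  moreover have "0 \<le> low_root UNIV j i" using posroot_low_root[of j UNIV] by (simp add: posroot_def)
  ultimately show ?thesis using Inl by simp
next
  case (Inr x)
  then have "root_coeff A (\<lambda>k. inv cox (vtx_weight t) k - vtx_weight t k) i = x i"
    using root_coeff_low[of x i] by simp
  moreover have "0 \<le> x i" using t Inr by (simp add: posroot_def)
  ultimately show ?thesis using Inr dpos[of i] by simp
qed

text \<open>Invariance moves the first argument along \<open>tau_inv\<close> to a fundamental
  weight, where the second axiom prescribes the value; scaled degree and norm do not change on the
  way.\<close>

lemma compat_degree_unique:
  assumes f: "is_compat_degree A cox f" and s: "s \<in> vtx UNIV" and t: "t \<in> vtx UNIV"
  shows "real_of_int (f (vtx_weight s) (vtx_weight t)) = scaled_degree s t / vtx_norm s"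
proof -
  have step: "f (vtx_weight (tau_inv UNIV s)) (vtx_weight (tau_inv UNIV t)) = f (vtx_weight s) (vtx_weight t)"
    if "s \<in> vtx UNIV" "t \<in> vtx UNIV" for s t
  proof -
    have "vtx_weight (tau_inv UNIV s) \<in> Pi_c A cox" "vtx_weight (tau_inv UNIV t) \<in> Pi_c A cox"
      using that by (simp_all add: Pi_c_vtx_weight)
    then have "f (tau_c cox (vtx_weight (tau_inv UNIV s))) (tau_c cox (vtx_weight (tau_inv UNIV t)))
        = f (vtx_weight (tau_inv UNIV s)) (vtx_weight (tau_inv UNIV t))"
      using f unfolding is_compat_degree_def by blast
    then show ?thesis using that by (simp add: tau_c_vtx_weight_tau_inv)
  qed
  have "real_of_int (f (vtx_weight s) (vtx_weight t)) = scaled_degree s t / vtx_norm s"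
    if "s \<in> vtx UNIV" "t \<in> vtx UNIV" "(tau_inv UNIV ^^ n) s = Inl i" for n s t i
    using that
  proof (induction n arbitrary: s t)
    case 0
    have "vtx_weight t \<in> Pi_c A cox" using 0 by (simp add: Pi_c_vtx_weight)
    then have "f (fund_weight i) (vtx_weight t) = max 0 (root_coeff A (\<lambda>k. inv cox (vtx_weight t) k - vtx_weight t k) i)"
      using f unfolding is_compat_degree_def by blast
    then show ?case using 0 root_coeff_vtx_weight[OF 0(2)] by simp
  next
    case (Suc n)
    have "real_of_int (f (vtx_weight (tau_inv UNIV s)) (vtx_weight (tau_inv UNIV t)))
        = scaled_degree (tau_inv UNIV s) (tau_inv UNIV t) / vtx_norm (tau_inv UNIV s)"
      using Suc by (simp add: funpow_swap1)
    then show ?case using Suc.prems by (simp add: step scaled_degree_tau_inv vtx_norm_tau_inv)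
  qed
  then show ?thesis using tau_inv_reaches_Inl[OF s] s t by blast
qed

lemma compat_degree_exists:
  "\<exists>f. is_compat_degree A cox f \<and> (\<forall>l m. (l \<notin> Pi_c A cox \<or> m \<notin> Pi_c A cox) \<longrightarrow> f l m = 0)"
proof -
  define g where "g = the_inv_into (vtx UNIV) vtx_weight"
  have g: "g (vtx_weight t) = t" if "t \<in> vtx UNIV" for t
    unfolding g_def by (rule the_inv_into_f_f[OF vtx_weight_inj that])
  \<comment> \<open>The floor serves to produce an \<open>int\<close>: the quotient is an integer at
    a fundamental weight by \<open>root_coeff_vtx_weight\<close>, and it is constant under
    simultaneous \<open>tau_inv\<close>.\<close>
  define f where "f = (\<lambda>l m. if l \<in> Pi_c A cox \<and> m \<in> Pi_c A cox
      then \<lfloor>scaled_degree (g l) (g m) / vtx_norm (g l)\<rfloor> else 0)"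
  have f: "f (vtx_weight s) (vtx_weight t) = \<lfloor>scaled_degree s t / vtx_norm s\<rfloor>" if "s \<in> vtx UNIV" "t \<in> vtx UNIV" for s t
    unfolding f_def using that by (simp add: Pi_c_vtx_weight g)
  have "f (tau_c cox l) (tau_c cox m) = f l m" if lm: "l \<in> Pi_c A cox" "m \<in> Pi_c A cox" for l m
  proof -
    have "\<exists>s\<in>vtx UNIV. l = vtx_weight (tau_inv UNIV s)" if "l \<in> Pi_c A cox" for l
      using that bij_betw_imp_surj_on[OF tau_inv_bij[of UNIV]] unfolding Pi_c_vtx_weight by (metis imageE)
    then obtain s t where "s \<in> vtx UNIV" "t \<in> vtx UNIV" "l = vtx_weight (tau_inv UNIV s)" "m = vtx_weight (tau_inv UNIV t)"
      using lm by meson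
    then show ?thesis by (simp add: tau_c_vtx_weight_tau_inv f scaled_degree_tau_inv vtx_norm_tau_inv)
  qed
  moreover have "f (fund_weight i) l = max 0 (root_coeff A (\<lambda>k. inv cox l k - l k) i)"
    if "l \<in> Pi_c A cox" for i l
  proof -
    obtain t where t: "t \<in> vtx UNIV" "l = vtx_weight t" using \<open>l \<in> Pi_c A cox\<close> unfolding Pi_c_vtx_weight by blast
    have "f (vtx_weight (Inl i)) (vtx_weight t) = \<lfloor>scaled_degree (Inl i) t / d i\<rfloor>" using f[of "Inl i" t] t by simp
    also have "\<dots> = max 0 (root_coeff A (\<lambda>k. inv cox (vtx_weight t) k - vtx_weight t k) i)"
      unfolding root_coeff_vtx_weight[OF t(1), symmetric] by (rule floor_of_int)
    finally show ?thesis using t(2) by simp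
  qed
  ultimately have "is_compat_degree A cox f" unfolding is_compat_degree_def by blast
  moreover have "\<forall>l m. (l \<notin> Pi_c A cox \<or> m \<notin> Pi_c A cox) \<longrightarrow> f l m = 0" by (auto simp: f_def)
  ultimately show ?thesis by blast
qed

text \<open>The axioms fix the values on \<open>Pi_c\<close> and the default 0 fixes all others, so
  the definite description has exactly one candidate.\<close>

lemma is_compat_degree_compat_degree: "is_compat_degree A cox (compat_degree A cox)"
proof -
  let ?P = "\<lambda>f. is_compat_degree A cox f \<and> (\<forall>l m. (l \<notin> Pi_c A cox \<or> m \<notin> Pi_c A cox) \<longrightarrow> f l m = 0)"
  obtain f where f: "?P f" using compat_degree_exists by blast
  have "f' = f" if f': "?P f'" for f'
  proof (rule ext, rule ext)
    fix l m
    show "f' l m = f l m"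
    proof (cases "l \<in> Pi_c A cox \<and> m \<in> Pi_c A cox")
      case True
      then obtain s t where st: "s \<in> vtx UNIV" "t \<in> vtx UNIV" "l = vtx_weight s" "m = vtx_weight t"
        unfolding Pi_c_vtx_weight by blast
      have "real_of_int (f' l m) = real_of_int (f l m)"
        using compat_degree_unique[OF _ st(1,2)] f f' st(3,4) by metis
      then show ?thesis by simp
    next
      case False
      then show ?thesis using f f' by metis
    qed
  qed
  then have "compat_degree A cox = f" unfolding compat_degree_def using f by (intro the_equality) blast+
  then show ?thesis using f by simp
qed

section \<open>Transfer of clusters and bases from vertices to weights\<close>

lemma c_compatible_iff:
  assumes "s \<in> vtx UNIV" "t \<in> vtx UNIV"
  shows "c_compatible A cox (vtx_weight s) (vtx_weight t) \<longleftrightarrow> scaled_degree s t = 0"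
proof -
  have "real_of_int (compat_degree A cox (vtx_weight s) (vtx_weight t)) = scaled_degree s t / vtx_norm s"
    by (rule compat_degree_unique[OF is_compat_degree_compat_degree assms])
  then show ?thesis using vtx_norm_pos[OF assms(1)] unfolding c_compatible_def
    by (metis divide_eq_0_iff less_irrefl of_int_eq_0_iff)
qed

lemma pairwise_c_compatible_iff:
  assumes "S \<subseteq> vtx UNIV"
  shows "pairwise_c_compatible A cox (vtx_weight ` S) \<longleftrightarrow> pairwise_zero S"
proof -
  have "vtx_weight s = vtx_weight t \<longleftrightarrow> s = t" "c_compatible A cox (vtx_weight s) (vtx_weight t) \<longleftrightarrow> scaled_degree s t = 0"
    if "s \<in> S" "t \<in> S" for s t
    using that assms inj_onD[OF vtx_weight_inj] c_compatible_iff by blast+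
  then show ?thesis
    unfolding pairwise_c_compatible_def pairwise_zero_def by (auto simp: ball_simps simp del: vtx_weight.simps)
qed

lemma Z_basis_of_zbasis:
  assumes b: "zbasis UNIV S" and S: "S \<subseteq> vtx UNIV"
  shows "Z_basis_of_P (vtx_weight ` S)"
  unfolding Z_basis_of_P_def
proof (intro conjI allI)
  show "finite (vtx_weight ` S)" using b by (simp add: zbasis_def)
  have inj: "inj_on vtx_weight S" using vtx_weight_inj S by (rule inj_on_subset)
  have sum: "(\<Sum>x\<in>vtx_weight ` S. a x * x k) = (\<Sum>t\<in>S. a (vtx_weight t) * vtx_weight t k)" for a :: "('i \<Rightarrow> int) \<Rightarrow> int" and k
    by (simp add: sum.reindex[OF inj])
  fix v :: "'i \<Rightarrow> int"
  obtain a where a: "\<And>k. k \<in> UNIV \<Longrightarrow> v k = (\<Sum>t\<in>S. a t * vtx_weight t k)"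
    using zbasis_span[OF b, of v] by blast
  \<comment> \<open>Coefficients pass from vertices to weights by injectivity, with value 0 off the
    set as the uniqueness in \<open>Z_basis_of_P\<close> demands.\<close>
  define a' where "a' = (\<lambda>x. if x \<in> vtx_weight ` S then a (the_inv_into S vtx_weight x) else 0)"
  have a': "a' (vtx_weight t) = a t" if "t \<in> S" for t
    using that by (simp add: a'_def the_inv_into_f_f[OF inj])
  show "\<exists>!a. (\<forall>x. x \<notin> vtx_weight ` S \<longrightarrow> a x = 0) \<and> v = (\<lambda>k. \<Sum>x\<in>vtx_weight ` S. a x * x k)"
  proof (rule ex1I[of _ a'], intro conjI allI impI)
    show "v = (\<lambda>k. \<Sum>x\<in>vtx_weight ` S. a' x * x k)"
    proof
      fix k
      have "(\<Sum>t\<in>S. a' (vtx_weight t) * vtx_weight t k) = (\<Sum>t\<in>S. a t * vtx_weight t k)"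
        by (rule sum.cong) (simp_all only: a')
      then show "v k = (\<Sum>x\<in>vtx_weight ` S. a' x * x k)" using a[of k] sum[of a' k] by simp
    qed
  next
    fix e assume e: "(\<forall>x. x \<notin> vtx_weight ` S \<longrightarrow> e x = 0) \<and> v = (\<lambda>k. \<Sum>x\<in>vtx_weight ` S. e x * x k)"
    have "(\<Sum>t\<in>S. (e (vtx_weight t) - a t) * vtx_weight t k) = 0" for k
    proof -
      have "v k = (\<Sum>t\<in>S. e (vtx_weight t) * vtx_weight t k)"
        using fun_cong[OF conjunct2[OF e], of k] sum[of e k] by simp
      then show ?thesis using a[of k] by (simp add: left_diff_distrib sum_subtractf)
    qed
    then have "e (vtx_weight t) - a t = 0" if "t \<in> S" for t
      using zbasis_indep[OF b, of "\<lambda>t. e (vtx_weight t) - a t"] that by blast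
    then have on: "e (vtx_weight t) = a' (vtx_weight t)" if "t \<in> S" for t using that a' by force
    show "e = a'"
    proof
      fix x show "e x = a' x"
        using on conjunct1[OF e] by (cases "x \<in> vtx_weight ` S") (auto simp: a'_def simp del: vtx_weight.simps)
    qed
  qed (simp add: a'_def)
qed

lemma c_cluster_Z_basis:
  assumes "c_cluster A cox S" shows "Z_basis_of_P S"
proof -
  define S' where "S' = {t \<in> vtx UNIV. vtx_weight t \<in> S}"
  have S: "S \<subseteq> Pi_c A cox" "pairwise_c_compatible A cox S"
    and max: "\<And>T. S \<subseteq> T \<Longrightarrow> T \<subseteq> Pi_c A cox \<Longrightarrow> pairwise_c_compatible A cox T \<Longrightarrow> T = S"
    using assms unfolding c_cluster_def by simp_all
  have sub: "S' \<subseteq> vtx UNIV" and SS: "S = vtx_weight ` S'"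
    using S(1) unfolding S'_def Pi_c_vtx_weight by auto
  have "cluster UNIV S'"
    unfolding cluster_def
  proof (intro conjI allI impI)
    show "S' \<subseteq> vtx UNIV" by fact
    show "pairwise_zero S'" using S(2) SS pairwise_c_compatible_iff[OF sub] by simp
    fix T assume T: "S' \<subseteq> T \<and> T \<subseteq> vtx UNIV \<and> pairwise_zero T"
    then have "pairwise_c_compatible A cox (vtx_weight ` T)" using pairwise_c_compatible_iff[of T] by simp
    moreover have "S \<subseteq> vtx_weight ` T" "vtx_weight ` T \<subseteq> Pi_c A cox" using T SS Pi_c_vtx_weight by auto
    ultimately have "vtx_weight ` T = S" using max by simp
    then show "T = S'" using T unfolding S'_def by blast
  qed
  then show ?thesis using cluster_zbasis Z_basis_of_zbasis[OF _ sub] SS by simp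
qed

end

theorem theorem2p1:
  fixes A :: "'i::finite \<Rightarrow> 'i \<Rightarrow> int"
    and c :: "('i \<Rightarrow> int) \<Rightarrow> ('i \<Rightarrow> int)"
    and S :: "('i \<Rightarrow> int) set"
  assumes "finite_type_cartan A"
    and "coxeter_element A c"
    and "c_cluster A c S"
  shows "Z_basis_of_P S"
proof -
  obtain ws where ws: "distinct ws" "set ws = UNIV" "c = word_elt A ws"
    using assms(2) unfolding coxeter_element_def by blast
  obtain d :: "'i \<Rightarrow> real" where d: "\<forall>i. d i > 0"
      "\<forall>i j. d i * real_of_int (A i j) = d j * real_of_int (A j i)"
      "\<forall>x :: 'i \<Rightarrow> real. (\<exists>i. x i \<noteq> 0) \<longrightarrow>
         (\<Sum>i\<in>UNIV. \<Sum>j\<in>UNIV. x i * d i * real_of_int (A i j) * x j) > 0"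
    using assms(1) unfolding finite_type_cartan_def by (elim conjE exE) (rule that; assumption)
  \<comment> \<open>\<open>r i\<close> is the position of the letter \<open>i\<close> in the word,
    well defined as every letter occurs exactly once.\<close>
  define r where "r = the_inv_into {..<length ws} (nth ws)"
  have inj: "inj_on (nth ws) {..<length ws}" using ws(1) by (simp add: inj_on_nth)
  have r: "r (ws ! n) = n" if "n < length ws" for n
    unfolding r_def using inj that by (simp add: the_inv_into_f_f)
  interpret cartan A d r ws
  proof
    show "inj r"
    proof (rule injI)
      fix i j assume "r i = r j"
      moreover obtain m n where "m < length ws" "i = ws ! m" "n < length ws" "j = ws ! n"
        using ws(2) by (metis UNIV_I in_set_conv_nth)
      ultimately show "i = j" using r by simp
    qed
    show "sorted_wrt (\<lambda>i j. r i < r j) ws"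
      unfolding sorted_wrt_iff_nth_less using r by simp
  qed (use assms(1) d ws in \<open>auto simp: finite_type_cartan_def\<close>)
  show ?thesis using assms(3) ws(3) c_cluster_Z_basis unfolding cox_def by simp
qed

end
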